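(* Let $0\le\alpha<1$. A log-harmonic mapping $f(z)=zh(z)\overline{g(z)}$ on $\mathbb{D}$ (with $\mu(0)=0$ and $h,g$ normalized as in the context) belongs to $\mathcal{S}^{*}_{Lh}(\alpha)$ if and only if there are two probability measures $\delta$ and $\kappa$ on $\partial\mathbb{D}$ such that, for all $z\in\mathbb{D}$, $$h(z)=\exp\left(\int_{\partial\mathbb{D}}\int_{\partial\mathbb{D}}K_1(z,\eta,\xi)\,d\delta(\eta)\,d\kappa(\xi)\right)$$ and $$g(z)=\exp\left(\int_{\partial\mathbb{D}}\int_{\partial\mathbb{D}}K_2(z,\eta,\xi)\,d\delta(\eta)\,d\kappa(\xi)\right),$$ where, for $|\eta|=|\xi|=1$, $$K_1(z,\eta,\xi)=\begin{cases}\dfrac{(1-2\alpha)\eta+\xi}{\eta-\xi}\log\left(\dfrac{1-\xi z}{1-\eta z}\right)-\log(1-\eta z) & \text{if } \eta\neq\xi,\\[2mm] \dfrac{2(1-\alpha)\eta z}{1-\eta z}-\log(1-\eta z) & \text{if } \eta=\xi,\end{cases}$$ and $$K_2(z,\eta,\xi)=\begin{cases}\dfrac{(1-2\alpha)\eta+\xi}{\eta-\xi}\log\left(\dfrac{1-\xi z}{1-\eta z}\right)+(1-2\alpha)\log(1-\eta z) & \text{if } \eta\neq\xi,\\[2mm] \dfrac{2(1-\alpha)\eta z}{1-\eta z}+(1-2\alpha)\log(1-\eta z) & \text{if } \eta=\xi.\end{cases}$$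
   Context: $\mathbb{D}=\{z\in\mathbb{C}:|z|<1\}$. A log-harmonic mapping on $\mathbb{D}$ is a solution $f$ of $\overline{f_{\overline z}}/\overline{f}=\mu\, f_z/f$ for some analytic $\mu:\mathbb{D}\to\mathbb{C}$ with $|\mu(z)|<1$ on $\mathbb{D}$; $\mu$ is the (second complex) dilatation of $f$. We consider log-harmonic mappings with $\mu(0)=0$ of the form $f(z)=zh(z)\overline{g(z)}$, where $h(z)=\exp\left(\sum_{n\ge1}a_nz^n\right)$ and $g(z)=\exp\left(\sum_{n\ge1}b_nz^n\right)$ are analytic in $\mathbb{D}$ (so $h,g$ are non-vanishing and $h(0)=g(0)=1$); then $\mu(z)=\dfrac{zg'(z)/g(z)}{1+zh'(z)/h(z)}$. For $0\le\alpha<1$, $\mathcal{S}^{*}_{Lh}(\alpha)$ is the class of univalent log-harmonic mappings $f$ of this form such that $\operatorname{Re}\left(\dfrac{zf_z(z)-\overline{z}f_{\overline z}(z)}{f(z)}\right)>\alpha$ for all $z\in\mathbb{D}\setminus\{0\}$ (log-harmonic starlike mappings of order $\alpha$). Logarithms are the branches in $z\in\mathbb{D}$ vanishing at $z=0$, so $\log\frac{1-\xi z}{1-\eta z}=\log(1-\xi z)-\log(1-\eta z)$ with principal logarithms. *)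

theory Defs
  imports "HOL-Complex_Analysis.Complex_Analysis" "HOL-Probability.Probability"
begin

abbreviation unit_disc :: "complex set" where
  "unit_disc \<equiv> ball 0 1"

text \<open>
  Wirtinger derivatives \<open>f\<^sub>z = (f\<^sub>x - \<i> f\<^sub>y) / 2\<close> and \<open>f\<^sub>z\<^sub>b\<^sub>a\<^sub>r = (f\<^sub>x + \<i> f\<^sub>y) / 2\<close>, where
  \<open>f\<^sub>x\<close> and \<open>f\<^sub>y\<close> are the values of the real Frechet derivative at \<open>1\<close> and \<open>\<i>\<close>.
\<close>

definition deriv_z :: "(complex \<Rightarrow> complex) \<Rightarrow> complex \<Rightarrow> complex" where
  "deriv_z f z = (frechet_derivative f (at z) 1 - \<i> * frechet_derivative f (at z) \<i>) / 2"

definition deriv_zbar :: "(complex \<Rightarrow> complex) \<Rightarrow> complex \<Rightarrow> complex" where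
  "deriv_zbar f z = (frechet_derivative f (at z) 1 + \<i> * frechet_derivative f (at z) \<i>) / 2"

text \<open>
  The equation divides by \<open>f\<close>, so it is imposed away from the zeros of \<open>f\<close>; at a zero
  only continuity is required. Here \<open>differentiable\<close> means real differentiability.
\<close>

definition log_harmonic_with_dilatation ::
    "(complex \<Rightarrow> complex) \<Rightarrow> (complex \<Rightarrow> complex) \<Rightarrow> bool" where
  "log_harmonic_with_dilatation f \<mu> \<longleftrightarrow>
     \<mu> holomorphic_on unit_disc \<and> (\<forall>z\<in>unit_disc. norm (\<mu> z) < 1) \<and>
     continuous_on unit_disc f \<and>
     (\<forall>z\<in>unit_disc. f z \<noteq> 0 \<longrightarrow>
        f differentiable (at z) \<and>
        cnj (deriv_zbar f z) / cnj (f z) = \<mu> z * (deriv_z f z / f z))"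

definition exp_power_series :: "(complex \<Rightarrow> complex) \<Rightarrow> bool" where
  "exp_power_series h \<longleftrightarrow>
     (\<exists>a :: nat \<Rightarrow> complex. \<forall>z\<in>unit_disc.
        summable (\<lambda>n. a (Suc n) * z ^ Suc n) \<and> h z = exp (\<Sum>n. a (Suc n) * z ^ Suc n))"

definition normalized_log_harmonic ::
    "(complex \<Rightarrow> complex) \<Rightarrow> (complex \<Rightarrow> complex) \<Rightarrow> (complex \<Rightarrow> complex) \<Rightarrow> bool" where
  "normalized_log_harmonic f h g \<longleftrightarrow>
     (\<exists>\<mu>. log_harmonic_with_dilatation f \<mu> \<and> \<mu> 0 = 0) \<and>
     exp_power_series h \<and> exp_power_series g \<and>
     (\<forall>z\<in>unit_disc. f z = z * h z * cnj (g z))"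

definition starlike_log_harmonic :: "real \<Rightarrow> (complex \<Rightarrow> complex) set" where
  "starlike_log_harmonic \<alpha> =
     {f. (\<exists>h g. normalized_log_harmonic f h g) \<and> inj_on f unit_disc \<and>
         (\<forall>z\<in>unit_disc - {0}. Re ((z * deriv_z f z - cnj z * deriv_zbar f z) / f z) > \<alpha>)}"

definition circle_prob_measure :: "complex measure \<Rightarrow> bool" where
  "circle_prob_measure M \<longleftrightarrow> prob_space M \<and> sets M = sets (restrict_space borel (sphere 0 1))"

definition K1 :: "real \<Rightarrow> complex \<Rightarrow> complex \<Rightarrow> complex \<Rightarrow> complex" where
  "K1 \<alpha> z \<eta> \<xi> =
     (if \<eta> \<noteq> \<xi>
      then ((1 - 2 * of_real \<alpha>) * \<eta> + \<xi>) / (\<eta> - \<xi>) * (Ln (1 - \<xi> * z) - Ln (1 - \<eta> * z))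
             - Ln (1 - \<eta> * z)
      else 2 * (1 - of_real \<alpha>) * \<eta> * z / (1 - \<eta> * z) - Ln (1 - \<eta> * z))"

definition K2 :: "real \<Rightarrow> complex \<Rightarrow> complex \<Rightarrow> complex \<Rightarrow> complex" where
  "K2 \<alpha> z \<eta> \<xi> =
     (if \<eta> \<noteq> \<xi>
      then ((1 - 2 * of_real \<alpha>) * \<eta> + \<xi>) / (\<eta> - \<xi>) * (Ln (1 - \<xi> * z) - Ln (1 - \<eta> * z))
             + (1 - 2 * of_real \<alpha>) * Ln (1 - \<eta> * z)
      else 2 * (1 - of_real \<alpha>) * \<eta> * z / (1 - \<eta> * z) + (1 - 2 * of_real \<alpha>) * Ln (1 - \<eta> * z))"

end

theory Submission
  imports Defs
begin

text \<open>
  Write \<open>h = exp a\<close> and \<open>g = exp b\<close> with \<open>a\<close> and \<open>b\<close> holomorphic and vanishing at the origin, and put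
  \<open>A = 1 + z a'\<close> and \<open>B = z b'\<close>. The log-harmonic equation says \<open>B = \<mu> A\<close>, and the starlikeness
  functional has real part \<open>Re (A - B)\<close> (\<open>starlike_log_harmonic_iff\<close>). So the starlike mappings
  correspond to pairs of functions with positive real part and value \<open>1\<close> at the origin, namely
  \<open>p = (A (1 - \<mu>) - \<alpha>) / (1 - \<alpha>)\<close>, which expresses starlikeness of order \<open>\<alpha>\<close>, and
  \<open>q = (1 + \<mu>) / (1 - \<mu>)\<close>, which expresses \<open>norm \<mu> < 1\<close>. Conversely
  \<open>A = (\<alpha> + (1 - \<alpha>) p) (q + 1) / 2\<close> and \<open>B = (\<alpha> + (1 - \<alpha>) p) (q - 1) / 2\<close>.

  By Herglotz's theorem (\<open>herglotz_representation\<close>) \<open>p\<close> and \<open>q\<close> are averages of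
  \<open>(1 + \<eta> z) / (1 - \<eta> z)\<close> over probability measures \<open>\<delta>\<close> and \<open>\<kappa>\<close> on the circle. Inserting these,
  \<open>a' = (A - 1) / z\<close> and \<open>b' = B / z\<close> become double integrals of rational functions of \<open>z\<close>, and the
  kernels \<open>K1\<close> and \<open>K2\<close> are their antiderivatives that vanish at the origin
  (\<open>K1_double_integral_deriv\<close>, \<open>K2_double_integral_deriv\<close>). Comparing derivatives gives both
  directions of the equivalence, except that the converse also has to supply univalence of \<open>f\<close>.

  For univalence (\<open>log_harmonic_injective\<close>) pass to \<open>w = log z\<close> in the left half plane. There
  \<open>log f = F + 2 Re L\<close> where \<open>F'\<close> and \<open>L'\<close> at \<open>w\<close> are \<open>A - B\<close> and \<open>B\<close> at \<open>exp w\<close>. As \<open>Re (F')\<close> is positive, every level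
  set of \<open>Im F = Im (log f)\<close> is a graph over the negative real axis (\<open>level_curve\<close>), and \<open>Re (log f)\<close>
  increases strictly along it because \<open>Re (1 + 2 L' / F') = Re ((1 + \<mu>) / (1 - \<mu>))\<close> is positive.
\<close>

section \<open>Herglotz integrals\<close>

definition herglotz_integral :: "complex measure \<Rightarrow> complex \<Rightarrow> complex" where
  "herglotz_integral \<delta> z = (LINT \<eta>|\<delta>. (1 + \<eta> * z) / (1 - \<eta> * z))"

lemma unit_circle_factor_nonzero:
  assumes "norm (\<eta> :: complex) = 1" "norm z < 1"
  shows "1 - \<eta> * z \<noteq> 0"
proof
  assume "1 - \<eta> * z = 0"
  then have "norm (\<eta> * z) = 1" by simp
  with assms show False by (simp add: norm_mult)
qed

lemma unit_circle_factor_bound: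
  assumes "norm (\<eta> :: complex) = 1"
  shows "1 - norm z \<le> norm (1 - \<eta> * z)"
  using norm_triangle_ineq2[of 1 "\<eta> * z"] assms by (simp add: norm_mult)

lemma circle_prob_measureD:
  assumes "circle_prob_measure \<delta>"
  shows "prob_space \<delta>" "space \<delta> = sphere 0 1" "(\<lambda>x. x) \<in> measurable \<delta> borel"
proof -
  have sets: "sets \<delta> = sets (restrict_space borel (sphere 0 1))"
    using assms by (simp add: circle_prob_measure_def)
  show "prob_space \<delta>" using assms by (simp add: circle_prob_measure_def)
  show "space \<delta> = sphere 0 1" using sets_eq_imp_space_eq[OF sets] by (simp add: space_restrict_space)
  show "(\<lambda>x. x) \<in> measurable \<delta> borel"
    unfolding measurable_cong_sets[OF sets refl] by (rule measurable_restrict_space1) simp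
qed

lemma herglotz_kernel_integrable:
  assumes \<delta>: "circle_prob_measure \<delta>" and z: "norm z < 1"
  shows "integrable \<delta> (\<lambda>\<eta>. (1 + \<eta> * z) / (1 - \<eta> * z))"
proof -
  interpret prob_space \<delta> by (rule circle_prob_measureD[OF \<delta>])
  note [measurable] = circle_prob_measureD(3)[OF \<delta>]
  have "norm ((1 + \<eta> * z) / (1 - \<eta> * z)) \<le> 2 / (1 - norm z)" if "norm \<eta> = 1" for \<eta>
  proof -
    have "norm (1 + \<eta> * z) \<le> 2"
      using norm_triangle_ineq[of 1 "\<eta> * z"] z that by (simp add: norm_mult)
    with unit_circle_factor_bound[OF that, of z] z show ?thesis
      by (auto simp: norm_divide intro!: frac_le)
  qed
  then show ?thesis
    by (intro integrable_const_bound[where B = "2 / (1 - norm z)"])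
       (auto simp: circle_prob_measureD[OF \<delta>] intro!: AE_I2)
qed

text \<open>
  The map \<open>w \<mapsto> (1 + w) / (1 - w)\<close> sends the unit disc to the right half plane. It occurs both as
  the Herglotz kernel, with \<open>w = \<eta> z\<close>, and applied to a dilatation.
\<close>

lemma Re_cayley:
  "Re ((1 + w) / (1 - w)) = (1 - (norm w)\<^sup>2) / (norm (1 - w))\<^sup>2"
  unfolding Re_divide cmod_power2 by (simp add: algebra_simps power2_eq_square)

lemma Re_cayley_pos:
  assumes "norm w < 1"
  shows "Re ((1 + w) / (1 - w)) > 0"
proof -
  have "norm (1 - w) > 0" using assms by auto
  moreover have "(norm w)\<^sup>2 < 1" using assms by (simp add: abs_square_less_1)
  ultimately show ?thesis unfolding Re_cayley by simp
qed

text \<open>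
  For strict positivity of the integral the kernel needs a lower bound that is uniform in \<open>\<eta>\<close>;
  the denominator \<open>(norm (1 - \<eta> z))\<^sup>2\<close> is at most \<open>4\<close>.
\<close>

lemma Re_herglotz_integral_pos:
  assumes \<delta>: "circle_prob_measure \<delta>" and z: "norm z < 1"
  shows "Re (herglotz_integral \<delta> z) > 0"
proof -
  interpret prob_space \<delta> by (rule circle_prob_measureD[OF \<delta>])
  note int = herglotz_kernel_integrable[OF \<delta> z]
  have "(1 - (norm z)\<^sup>2) / 4 \<le> Re ((1 + \<eta> * z) / (1 - \<eta> * z))" if \<eta>: "norm \<eta> = 1" for \<eta>
  proof -
    have ne: "1 - \<eta> * z \<noteq> 0" by (rule unit_circle_factor_nonzero[OF \<eta> z])
    have eq: "Re ((1 + \<eta> * z) / (1 - \<eta> * z)) = (1 - (norm z)\<^sup>2) / (norm (1 - \<eta> * z))\<^sup>2"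
      using Re_cayley[of "\<eta> * z"] \<eta> by (simp add: norm_mult)
    have "norm (1 - \<eta> * z) \<le> 2"
      using norm_triangle_ineq4[of 1 "\<eta> * z"] z \<eta> by (simp add: norm_mult)
    then have "(norm (1 - \<eta> * z))\<^sup>2 \<le> 4" using power_mono[of "norm (1 - \<eta> * z)" 2 2] by simp
    then show ?thesis unfolding eq using ne z
      by (intro divide_left_mono) (auto simp: power_le_one abs_square_le_1)
  qed
  then have "(1 - (norm z)\<^sup>2) / 4 \<le> (LINT \<eta>|\<delta>. Re ((1 + \<eta> * z) / (1 - \<eta> * z)))"
    by (intro integral_ge_const integrable_Re int AE_I2) (auto simp: circle_prob_measureD[OF \<delta>])
  moreover have "(norm z)\<^sup>2 < 1" using z by (simp add: power_less_one_iff abs_square_less_1)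
  ultimately show ?thesis
    unfolding herglotz_integral_def using integral_Re[OF int] by simp
qed

section \<open>The Herglotz representation theorem\<close>

text \<open>
  Cauchy's formula on the circle parametrised at constant speed by \<open>[0, 1]\<close>. In this form it is
  an average against Lebesgue measure, from which probability densities can be read off.
\<close>

lemma circle_cauchy_formula:
  assumes G: "G holomorphic_on cball 0 1" and z: "norm z < 1"
  shows "((\<lambda>t. G (cis (2 * pi * t)) * (cis (2 * pi * t) / (cis (2 * pi * t) - z))) has_integral G z) {0..1}"
proof -
  have e: "exp (2 * complex_of_real pi * \<i> * complex_of_real t) = cis (2 * pi * t)" for t
    by (simp add: cis_conv_exp mult_ac)
  have "((\<lambda>u. G u / (u - z)) has_contour_integral 2 * of_real pi * \<i> * G z) (circlepath 0 1)"
    using Cauchy_integral_circlepath_simple[OF G, of z] z by simp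
  then have "((\<lambda>t. G (cis (2 * pi * t)) / (cis (2 * pi * t) - z) * (2 * of_real pi * \<i> * cis (2 * pi * t)))
      has_integral 2 * of_real pi * \<i> * G z) {0..1}"
    unfolding has_contour_integral_def
    by (rule has_integral_eq[rotated])
       (subst vector_derivative_circlepath01, auto simp: circlepath e)
  from has_integral_mult_right[OF this, of "1 / (2 * of_real pi * \<i>)"] show ?thesis
    by (simp add: field_simps)
qed

text \<open>
  Average \<open>G\<close> and its conjugate against the kernel \<open>(\<zeta> + z) / (\<zeta> - z)\<close>, where \<open>\<zeta>\<close> runs over the
  circle. The kernel is \<open>2 \<zeta> / (\<zeta> - z) - 1\<close>, so Cauchy's formula gives \<open>2 G z - G 0\<close> for \<open>G\<close>.
  On the circle the kernel is also the conjugate of a function that is holomorphic across the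
  closed disc and equal to \<open>1\<close> at the centre, so the conjugate of \<open>G\<close> contributes only
  \<open>cnj (G 0)\<close>. Half the sum is the claim. The kernel is displayed in terms of
  \<open>\<eta> = cnj \<zeta>\<close>, the form in which it occurs in the Herglotz integral.
\<close>

lemma schwarz_integral_formula:
  assumes G: "G holomorphic_on cball 0 1" and G0: "Im (G 0) = 0" and z: "norm z < 1"
  shows "((\<lambda>t. Re (G (cis (2 * pi * t))) *\<^sub>R
            ((1 + cis (- (2 * pi * t)) * z) / (1 - cis (- (2 * pi * t)) * z))) has_integral G z) {0..1}"
proof -
  let ?e = "\<lambda>t. cis (2 * pi * t)"
  have ne: "?e t - w \<noteq> 0" if "norm w < 1" for t w
  proof
    assume "?e t - w = 0"
    then have "w = ?e t" by simp
    with that show False by simp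
  qed
  have ne': "1 - cnj z * w \<noteq> 0" if "norm w \<le> 1" for w
  proof
    assume "1 - cnj z * w = 0"
    then have "norm (cnj z * w) = 1" by simp
    moreover have "norm (cnj z * w) \<le> norm z * 1"
      unfolding norm_mult complex_mod_cnj using that by (intro mult_left_mono) auto
    ultimately show False using z by simp
  qed
  have I0: "((\<lambda>t. G (?e t)) has_integral G 0) {0..1}"
    using circle_cauchy_formula[OF G, of 0] by simp
  have "((\<lambda>t. 2 * (G (?e t) * (?e t / (?e t - z))) - G (?e t)) has_integral 2 * G z - G 0) {0..1}"
    by (intro has_integral_diff has_integral_mult_right circle_cauchy_formula G z I0)
  then have I1: "((\<lambda>t. G (?e t) * ((?e t + z) / (?e t - z))) has_integral 2 * G z - G 0) {0..1}"
    by (rule has_integral_eq[rotated]) (use ne[OF z] in \<open>simp add: field_simps\<close>)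
  have "(\<lambda>w. G w * ((1 + cnj z * w) / (1 - cnj z * w))) holomorphic_on cball 0 1"
    using ne' by (intro holomorphic_intros G) auto
  from circle_cauchy_formula[OF this, of 0]
  have "((\<lambda>t. G (?e t) * ((1 + cnj z * ?e t) / (1 - cnj z * ?e t))) has_integral G 0) {0..1}"
    by simp
  then have "((\<lambda>t. cnj (G (?e t) * ((1 + cnj z * ?e t) / (1 - cnj z * ?e t)))) has_integral cnj (G 0)) {0..1}"
    unfolding has_integral_cnj[symmetric, where f = "\<lambda>t. G (?e t) * _ t"] o_def .
  then have I2: "((\<lambda>t. cnj (G (?e t)) * ((?e t + z) / (?e t - z))) has_integral cnj (G 0)) {0..1}"
  proof (rule has_integral_eq[rotated], goal_cases)
    case (1 t)
    have "(1 + z * cnj (?e t)) / (1 - z * cnj (?e t))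
        = (?e t * (1 + z * cnj (?e t))) / (?e t * (1 - z * cnj (?e t)))"
      by simp
    also have "?e t * (1 + z * cnj (?e t)) = ?e t + z" 
      by (simp add: cis_cnj algebra_simps cis_mult)
    also have "?e t * (1 - z * cnj (?e t)) = ?e t - z" 
      by (simp add: cis_cnj algebra_simps cis_mult)
    finally have "(1 + z * cnj (?e t)) / (1 - z * cnj (?e t)) = (?e t + z) / (?e t - z)" .
    then show ?case
      by (simp del: times_divide_eq_right add: times_divide_eq_right[symmetric])
  qed
  have "((\<lambda>t. (1/2) * (G (?e t) * ((?e t + z) / (?e t - z)) + cnj (G (?e t)) * ((?e t + z) / (?e t - z))))
      has_integral (1/2) * ((2 * G z - G 0) + cnj (G 0))) {0..1}"
    by (intro has_integral_add has_integral_mult_right I1 I2)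
  then have "((\<lambda>t. Re (G (?e t)) *\<^sub>R ((?e t + z) / (?e t - z))) has_integral G z) {0..1}"
  proof (rule has_integral_eq_rhs[OF has_integral_eq[rotated]], goal_cases)
    case (1 t)
    have "(1/2) * (G (?e t) * w + cnj (G (?e t)) * w) = Re (G (?e t)) *\<^sub>R w" for w
      by (simp add: distrib_right[symmetric] complex_add_cnj scaleR_conv_of_real)
    then show ?case .
  next
    case 2
    have "cnj (G 0) = G 0" using G0 by (simp add: complex_eq_iff)
    then show ?case by simp
  qed
  then show ?thesis
  proof (rule has_integral_eq[rotated], goal_cases)
    case (1 t)
    have "(?e t + z) / (?e t - z) = (cis (- (2 * pi * t)) * (?e t + z)) / (cis (- (2 * pi * t)) * (?e t - z))"
      by simp
    also have "\<dots> = (1 + cis (- (2 * pi * t)) * z) / (1 - cis (- (2 * pi * t)) * z)"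
      by (simp add: distrib_left right_diff_distrib cis_mult)
    finally show ?case by simp
  qed
qed

text \<open>
  For \<open>r < 1\<close> the Schwarz formula represents \<open>p (r z)\<close> through the probability density
  \<open>Re (p (r \<zeta>))\<close> on the circle. These densities are viewed as distributions on the interval
  \<open>[0, 1]\<close> of the real line; there they are tight, so Helly's selection theorem provides a
  weakly convergent subsequence as \<open>r\<close> tends to \<open>1\<close>. The kernel is bounded and continuous, so
  the representation passes to the limit, and the limit is pushed forward to the circle by
  \<open>t \<mapsto> exp (- 2 \<pi> \<i> t)\<close>.
\<close>

theorem herglotz_representation:
  assumes hol: "p holomorphic_on unit_disc"
    and pos: "\<And>z. z \<in> unit_disc \<Longrightarrow> Re (p z) \<ge> 0" and p0: "p 0 = 1"
  obtains \<delta> where "circle_prob_measure \<delta>"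
    "\<And>z. z \<in> unit_disc \<Longrightarrow> p z = herglotz_integral \<delta> z"
proof -
  let ?e = "\<lambda>t. cis (2 * pi * t)"
  let ?P = "\<lambda>z t. (1 + cis (- (2 * pi * t)) * z) / (1 - cis (- (2 * pi * t)) * z)"
  \<comment> \<open>any sequence in \<open>(0, 1)\<close> with limit \<open>1\<close>\<close>
  define r where "r n = 1 - 1 / real (n + 2)" for n
  have r: "0 < r n" "r n < 1" for n
    by (auto simp: r_def field_simps)
  have r_lim: "r \<longlonglongrightarrow> 1"
  proof -
    have "(\<lambda>n. 1 / real (n + 2)) \<longlonglongrightarrow> 0"
      by (rule LIMSEQ_ignore_initial_segment[OF lim_1_over_n])
    then have "(\<lambda>n. 1 - 1 / real (n + 2)) \<longlonglongrightarrow> 1 - 0" by (intro tendsto_intros)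
    then show ?thesis unfolding r_def by simp
  qed
  have in_disc: "of_real (r n) * w \<in> unit_disc" if "norm w \<le> 1" for n w
  proof -
    have "r n * norm w \<le> r n * 1" using r[of n] that by (intro mult_left_mono) auto
    then have "r n * norm w < 1" using r(2)[of n] by linarith
    then show ?thesis using r(1)[of n] by (simp add: norm_mult)
  qed
  define G where "G n w = p (of_real (r n) * w)" for n w
  have G_hol: "G n holomorphic_on cball 0 1" for n
    unfolding G_def using in_disc
    by (intro holomorphic_on_compose_gen[OF _ hol, unfolded o_def] holomorphic_intros) auto
  have schwarz: "((\<lambda>t. Re (G n (?e t)) *\<^sub>R ?P z t) has_integral G n z) {0..1}" if "norm z < 1" for n z
    by (rule schwarz_integral_formula[OF G_hol _ that]) (simp add: G_def p0)
  have cont_e: "continuous_on S (\<lambda>t. G n (?e t))" for S n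
    by (rule continuous_on_compose2[OF holomorphic_on_imp_continuous_on[OF G_hol[of n]]])
       (auto intro!: continuous_intros)
  define d where "d n t = indicator {0..1} t * Re (G n (?e t))" for n and t :: real
  have d_nonneg: "d n t \<ge> 0" for n t
    unfolding d_def G_def by (intro mult_nonneg_nonneg pos in_disc) auto
  have [measurable]: "(\<lambda>t. G n (?e t)) \<in> borel_measurable borel" for n
    by (intro borel_measurable_continuous_onI cont_e)
  have d_meas[measurable]: "d n \<in> borel_measurable borel" for n
    unfolding d_def[abs_def] by measurable
  define \<mu> where "\<mu> n = density lborel (\<lambda>t. ennreal (d n t))" for n
  have d_int: "(d n has_integral 1) UNIV" for n
  proof -
    have "((\<lambda>t. Re (Re (G n (?e t)) *\<^sub>R ?P 0 t)) has_integral Re (G n 0)) {0..1}"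
      by (rule has_integral_Re[OF schwarz]) simp
    then have "((\<lambda>t. Re (G n (?e t))) has_integral 1) {0..1}"
      by (simp add: G_def p0)
    then have "((\<lambda>t. if t \<in> {0..1} then Re (G n (?e t)) else 0) has_integral 1) UNIV"
      by (simp only: has_integral_restrict_UNIV)
    then show ?thesis
      by (rule has_integral_eq[rotated]) (simp add: d_def indicator_def)
  qed
  have prob: "prob_space (\<mu> n)" for n
  proof (rule prob_spaceI)
    have "(\<integral>\<^sup>+ t. ennreal (d n t) \<partial>lborel) = ennreal 1"
      by (rule nn_integral_has_integral_lborel[OF _ d_nonneg d_int]) simp
    then show "emeasure (\<mu> n) (space (\<mu> n)) = 1"
      unfolding \<mu>_def by (subst emeasure_density) auto
  qed
  have distrib: "real_distribution (\<mu> n)" for n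
    unfolding real_distribution_def real_distribution_axioms_def
    using prob[of n] by (simp add: \<mu>_def)
  have "tight \<mu>"
    unfolding tight_def
  proof (intro conjI allI impI)
    fix \<epsilon> :: real assume "\<epsilon> > 0"
    \<comment> \<open>a half-open interval around \<open>[0, 1]\<close>, which carries all the mass\<close>
    have "measure (\<mu> n) {-1<..2} = 1" for n
    proof -
      interpret prob_space "\<mu> n" by (rule prob)
      have "AE t in \<mu> n. t \<in> {-1<..2}"
        unfolding \<mu>_def by (subst AE_density) (auto simp: d_def indicator_def intro!: AE_I2)
      then show ?thesis by (subst (asm) prob_eq_1[symmetric]) (auto simp: \<mu>_def)
    qed
    then have "(-1 :: real) < 2 \<and> (\<forall>n. 1 - \<epsilon> < measure (\<mu> n) {-1<..2})" using \<open>\<epsilon> > 0\<close> by simp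
    then show "\<exists>a b. a < b \<and> (\<forall>n. 1 - \<epsilon> < measure (\<mu> n) {a<..b})" by blast
  qed (rule distrib)
  from tight_imp_convergent_subsubsequence[OF this strict_mono_id]
  obtain s M where s: "strict_mono s" and M: "real_distribution M" and "weak_conv_m (\<mu> \<circ> id \<circ> s) M"
    by blast
  then have conv: "weak_conv_m (\<lambda>k. \<mu> (s k)) M" by (simp add: o_def)
  interpret M: real_distribution M by (rule M)
  let ?C = "restrict_space borel (sphere (0::complex) 1)"
  define \<delta> where "\<delta> = distr M ?C (\<lambda>t. cis (- (2 * pi * t)))"
  have meas: "(\<lambda>t. cis (- (2 * pi * t))) \<in> measurable M ?C"
    unfolding measurable_cong_sets[OF M.events_eq_borel refl]
    by (rule measurable_restrict_space2) (auto intro!: borel_measurable_continuous_onI continuous_intros)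
  have "circle_prob_measure \<delta>"
    unfolding circle_prob_measure_def \<delta>_def using M.prob_space_distr[OF meas] by simp
  moreover have "p z = herglotz_integral \<delta> z" if z: "z \<in> unit_disc" for z
  proof -
    have nz: "norm z < 1" using z by simp
    have ne: "1 - cis t * z \<noteq> 0" for t
      by (rule unit_circle_factor_nonzero[OF _ nz]) simp
    have cont_P: "isCont (?P z) t" for t
    proof -
      have "continuous_on UNIV (?P z)" by (intro continuous_intros) (use ne in blast)
      then show ?thesis by (simp add: continuous_on_eq_continuous_at)
    qed
    have bound_P: "norm (?P z t) \<le> 2 / (1 - norm z)" for t
    proof -
      have "norm (1 + cis (- (2 * pi * t)) * z) \<le> 2"
        using norm_triangle_ineq[of 1 "cis (- (2 * pi * t)) * z"] nz by (simp add: norm_mult)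
      moreover have "1 - norm z \<le> norm (1 - cis (- (2 * pi * t)) * z)"
        using norm_triangle_ineq2[of 1 "cis (- (2 * pi * t)) * z"] by (simp add: norm_mult)
      ultimately show ?thesis using nz by (auto simp: norm_divide intro!: frac_le)
    qed
    have lim: "(\<lambda>k. LINT t|\<mu> (s k). ?P z t) \<longlonglongrightarrow> (LINT t|M. ?P z t)"
      by (rule weak_conv_imp_integral_bdd_continuous_conv[OF distrib M conv cont_P bound_P])
    have P_meas[measurable]: "?P z \<in> borel_measurable borel"
      by (intro borel_measurable_continuous_onI) (auto simp: continuous_on_eq_continuous_at cont_P)
    have val: "(LINT t|\<mu> n. ?P z t) = G n z" for n
    proof -
      have "(LINT t|\<mu> n. ?P z t) = (LINT t|lborel. d n t *\<^sub>R ?P z t)"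
        unfolding \<mu>_def by (rule integral_density) (auto simp: d_nonneg)
      also have "\<dots> = (LINT t:{0..1}|lborel. Re (G n (?e t)) *\<^sub>R ?P z t)"
        unfolding set_lebesgue_integral_def d_def by simp
      also have "\<dots> = integral {0..1} (\<lambda>t. Re (G n (?e t)) *\<^sub>R ?P z t)"
        by (intro set_borel_integral_eq_integral(2) borel_integrable_atLeastAtMost'
            continuous_on_scaleR continuous_on_Re cont_e continuous_at_imp_continuous_on[OF ballI, OF cont_P])
      also have "\<dots> = G n z" using schwarz[OF nz] by (rule integral_unique)
      finally show ?thesis .
    qed
    have "(\<lambda>n. of_real (r n) * z) \<longlonglongrightarrow> of_real 1 * z"
      by (intro tendsto_intros r_lim)
    then have "(\<lambda>n. p (of_real (r n) * z)) \<longlonglongrightarrow> p z"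
      using holomorphic_on_imp_continuous_on[OF hol] in_disc[of z] z
      by (intro continuous_on_tendsto_compose[of unit_disc p]) auto
    from LIMSEQ_subseq_LIMSEQ[OF this s] have "(\<lambda>k. G (s k) z) \<longlonglongrightarrow> p z"
      by (simp add: G_def o_def)
    with lim have "p z = (LINT t|M. ?P z t)" unfolding val by (rule LIMSEQ_unique[rotated])
    also have "\<dots> = herglotz_integral \<delta> z"
      unfolding \<delta>_def herglotz_integral_def
      by (rule integral_distr[OF meas, symmetric]) (rule measurable_restrict_space1, measurable)
    finally show ?thesis .
  qed
  ultimately show ?thesis by (rule that)
qed

section \<open>The kernels and their double integrals\<close>

text \<open>
  Dominated convergence along sequences tending to \<open>z0\<close>: by the mean value inequality a bound on
  the derivative \<open>k\<close> near \<open>z0\<close> bounds all difference quotients of \<open>K\<close>. Measurability of \<open>k z0\<close>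
  is inherited from the difference quotients.
\<close>

lemma has_field_derivative_integral:
  fixes K k :: "complex \<Rightarrow> 'a \<Rightarrow> complex"
  assumes fin: "finite_measure M" and e: "e > 0"
    and deriv: "\<And>z x. z \<in> ball z0 e \<Longrightarrow> x \<in> space M \<Longrightarrow>
                  ((\<lambda>z. K z x) has_field_derivative k z x) (at z)"
    and bound: "\<And>z x. z \<in> ball z0 e \<Longrightarrow> x \<in> space M \<Longrightarrow> norm (k z x) \<le> C"
    and int: "\<And>z. z \<in> ball z0 e \<Longrightarrow> integrable M (K z)"
  shows "integrable M (k z0)" (is ?I)
    and "((\<lambda>z. LINT x|M. K z x) has_field_derivative (LINT x|M. k z0 x)) (at z0)" (is ?D)
proof -
  interpret finite_measure M by (rule fin)
  have z0: "z0 \<in> ball z0 e" using e by simp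
  let ?s = "\<lambda>X i x. (K (X i) x - K z0 x) / (X i - z0)"
  have dom: "integrable M (k z0) \<and> (\<lambda>i. LINT x|M. ?s X i x) \<longlonglongrightarrow> (LINT x|M. k z0 x)"
    if X: "\<And>i. X i \<in> ball z0 e - {z0}" "X \<longlonglongrightarrow> z0" for X :: "nat \<Rightarrow> complex"
  proof -
    have lim: "(\<lambda>i. ?s X i x) \<longlonglongrightarrow> k z0 x" if x: "x \<in> space M" for x
      using deriv[OF z0 x] X unfolding has_field_derivative_iff tendsto_at_iff_sequentially o_def
      by blast
    have s_int: "integrable M (?s X i)" for i
      using X(1)[of i] z0 by (intro integrable_divide Bochner_Integration.integrable_diff int) auto
    have [measurable]: "?s X i \<in> borel_measurable M" for i
      using s_int[of i] by (rule borel_measurable_integrable)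
    have k_meas: "k z0 \<in> borel_measurable M"
      using lim by (rule borel_measurable_LIMSEQ_metric[rotated]) measurable
    have s_bound: "norm (?s X i x) \<le> C" if x: "x \<in> space M" for i x
    proof -
      have "norm (K (X i) x - K z0 x) \<le> C * norm (X i - z0)"
        using X(1)[of i]
        by (intro field_differentiable_bound[of "ball z0 e" "\<lambda>z. K z x" "\<lambda>z. k z x"])
           (auto simp: x bound deriv e has_field_derivative_at_within)
      then show ?thesis using X(1)[of i] by (simp add: norm_divide divide_le_eq)
    qed
    have "integrable M (k z0)"
      by (rule integrable_dominated_convergence[where s = "?s X" and w = "\<lambda>_. C"])
         (auto intro!: k_meas s_bound lim AE_I2)
    moreover have "(\<lambda>i. LINT x|M. ?s X i x) \<longlonglongrightarrow> (LINT x|M. k z0 x)"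
      by (rule integral_dominated_convergence[where w = "\<lambda>_. C"])
         (auto intro!: k_meas s_bound lim AE_I2)
    ultimately show ?thesis by blast
  qed
  obtain X where X: "\<And>i::nat. X i \<in> ball z0 e - {z0}" "X \<longlonglongrightarrow> z0"
  proof -
    have "z0 islimpt ball z0 e" using e by (simp add: interior_limit_point)
    then show ?thesis using that unfolding islimpt_sequential by blast
  qed
  from dom[OF X] show ?I ..
  have "((\<lambda>z. ((LINT x|M. K z x) - (LINT x|M. K z0 x)) / (z - z0)) \<longlongrightarrow> (LINT x|M. k z0 x))
      (at z0 within ball z0 e)"
    unfolding tendsto_at_iff_sequentially o_def
  proof (intro allI impI)
    fix X :: "nat \<Rightarrow> complex" assume X: "\<forall>i. X i \<in> ball z0 e - {z0}" "X \<longlonglongrightarrow> z0"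
    have "(LINT x|M. ?s X i x) = ((LINT x|M. K (X i) x) - (LINT x|M. K z0 x)) / (X i - z0)" for i
      using X(1) z0 int by (simp add: Bochner_Integration.integral_diff)
    with dom[of X] X
    show "(\<lambda>i. ((LINT x|M. K (X i) x) - (LINT x|M. K z0 x)) / (X i - z0)) \<longlonglongrightarrow> (LINT x|M. k z0 x)"
      by simp
  qed
  then show ?D
    using e by (simp add: has_field_derivative_iff at_within_open[OF z0 open_ball])
qed

text \<open>
  The part that \<open>K1\<close> and \<open>K2\<close> have in common. It is the antiderivative, vanishing at the origin, of
  \<open>((1 - 2 \<alpha>) \<eta> + \<xi>) / ((1 - \<eta> z) (1 - \<xi> z))\<close>; partial fractions degenerate for \<open>\<eta> = \<xi>\<close>, which
  accounts for the case distinction, but the derivative is given by one formula.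
\<close>

definition kernel_core :: "real \<Rightarrow> complex \<Rightarrow> complex \<Rightarrow> complex \<Rightarrow> complex" where
  "kernel_core \<alpha> z \<eta> \<xi> = K1 \<alpha> z \<eta> \<xi> + Ln (1 - \<eta> * z)"

lemma K1_eq: "K1 \<alpha> z \<eta> \<xi> = kernel_core \<alpha> z \<eta> \<xi> - Ln (1 - \<eta> * z)"
  and K2_eq: "K2 \<alpha> z \<eta> \<xi> = kernel_core \<alpha> z \<eta> \<xi> + (1 - 2 * of_real \<alpha>) * Ln (1 - \<eta> * z)"
  by (simp_all add: kernel_core_def K1_def K2_def)

lemma has_field_derivative_Ln_factor:
  assumes "norm (\<eta> :: complex) = 1" "norm z < 1"
  shows "((\<lambda>z. Ln (1 - \<eta> * z)) has_field_derivative - \<eta> / (1 - \<eta> * z)) (at z)"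
proof -
  have "Re (\<eta> * z) < 1"
    using complex_Re_le_cmod[of "\<eta> * z"] assms by (simp add: norm_mult)
  then have "1 - \<eta> * z \<notin> \<real>\<^sub>\<le>\<^sub>0"
    by (auto simp: complex_nonpos_Reals_iff)
  then show ?thesis
    by (auto intro!: derivative_eq_intros simp: field_simps)
qed

lemma has_field_derivative_kernel_core:
  assumes \<eta>: "norm \<eta> = 1" and \<xi>: "norm \<xi> = 1" and z: "norm z < 1"
  shows "((\<lambda>z. kernel_core \<alpha> z \<eta> \<xi>) has_field_derivative
          ((1 - 2 * of_real \<alpha>) * \<eta> + \<xi>) / ((1 - \<eta> * z) * (1 - \<xi> * z))) (at z)"
proof (cases "\<eta> = \<xi>")
  case True
  note ne = unit_circle_factor_nonzero[OF \<eta> z]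
  have "((\<lambda>z. 2 * (1 - of_real \<alpha>) * \<eta> * z / (1 - \<eta> * z)) has_field_derivative
         (2 * (1 - of_real \<alpha>) * \<eta> * (1 - \<eta> * z) - 2 * (1 - of_real \<alpha>) * \<eta> * z * (- \<eta>))
            / ((1 - \<eta> * z) * (1 - \<eta> * z))) (at z)"
    by (rule derivative_eq_intros refl ne | simp)+
  with True show ?thesis by (simp add: kernel_core_def K1_def algebra_simps)
next
  case False
  note ne = unit_circle_factor_nonzero[OF \<eta> z] unit_circle_factor_nonzero[OF \<xi> z]
  let ?c = "(1 - 2 * of_real \<alpha>) * \<eta> + \<xi>"
  have "((\<lambda>z. ?c / (\<eta> - \<xi>) * (Ln (1 - \<xi> * z) - Ln (1 - \<eta> * z))) has_field_derivative
         ?c / (\<eta> - \<xi>) * (- \<xi> / (1 - \<xi> * z) - - \<eta> / (1 - \<eta> * z))) (at z)"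
    by (intro DERIV_cmult DERIV_diff has_field_derivative_Ln_factor assms)
  moreover have "- \<xi> / (1 - \<xi> * z) - - \<eta> / (1 - \<eta> * z) = (\<eta> - \<xi>) / ((1 - \<eta> * z) * (1 - \<xi> * z))"
    using ne by (simp add: divide_simps) (simp add: algebra_simps)
  ultimately show ?thesis using False by (simp add: kernel_core_def K1_def)
qed

lemma has_field_derivative_K1:
  assumes \<eta>: "norm \<eta> = 1" and \<xi>: "norm \<xi> = 1" and z: "norm z < 1"
  shows "((\<lambda>z. K1 \<alpha> z \<eta> \<xi>) has_field_derivative
          (2 * (1 - of_real \<alpha>) * \<eta> + \<xi> - \<eta> * \<xi> * z) / ((1 - \<eta> * z) * (1 - \<xi> * z))) (at z)"
  unfolding K1_eq using unit_circle_factor_nonzero[OF \<eta> z] unit_circle_factor_nonzero[OF \<xi> z]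
  by (intro DERIV_cong[OF DERIV_diff[OF has_field_derivative_kernel_core[OF assms] has_field_derivative_Ln_factor[OF \<eta> z]]])
     (simp add: divide_simps, simp add: algebra_simps)

lemma has_field_derivative_K2:
  assumes \<eta>: "norm \<eta> = 1" and \<xi>: "norm \<xi> = 1" and z: "norm z < 1"
  shows "((\<lambda>z. K2 \<alpha> z \<eta> \<xi>) has_field_derivative
          (\<xi> + (1 - 2 * of_real \<alpha>) * \<eta> * \<xi> * z) / ((1 - \<eta> * z) * (1 - \<xi> * z))) (at z)"
  unfolding K2_eq using unit_circle_factor_nonzero[OF \<eta> z] unit_circle_factor_nonzero[OF \<xi> z]
  by (intro DERIV_cong[OF DERIV_add[OF has_field_derivative_kernel_core[OF assms] DERIV_cmult[OF has_field_derivative_Ln_factor[OF \<eta> z]]]])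
     (simp add: divide_simps, simp add: algebra_simps)

lemma kernels_at_0: "K1 \<alpha> 0 \<eta> \<xi> = 0" "K2 \<alpha> 0 \<eta> \<xi> = 0"
  by (simp_all add: K1_def K2_def)

lemma kernel_measurable:
  "(\<lambda>(\<eta>, \<xi>). K1 \<alpha> z \<eta> \<xi>) \<in> borel_measurable (borel \<Otimes>\<^sub>M borel)"
  "(\<lambda>(\<eta>, \<xi>). K2 \<alpha> z \<eta> \<xi>) \<in> borel_measurable (borel \<Otimes>\<^sub>M borel)"
  unfolding K1_def K2_def by measurable

text \<open>
  Differentiation under both integrals, carried out on the product measure. The kernels have no
  evident bound in \<open>(\<eta>, \<xi>)\<close> near the diagonal \<open>\<eta> = \<xi>\<close>, where \<open>\<eta> - \<xi>\<close> is a denominator. Their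
  derivatives have one, of order \<open>(1 - norm z)\<^bsup>-2\<^esup>\<close>, and since the kernels vanish at
  \<open>z = 0\<close> it carries over to them by the mean value inequality.
\<close>

lemma has_field_derivative_double_integral:
  fixes K :: "complex \<Rightarrow> complex \<Rightarrow> complex \<Rightarrow> complex"
  assumes \<delta>: "circle_prob_measure \<delta>" and \<kappa>: "circle_prob_measure \<kappa>"
    and K0: "\<And>\<eta> \<xi>. K 0 \<eta> \<xi> = 0"
    and deriv: "\<And>z \<eta> \<xi>. norm z < 1 \<Longrightarrow> norm \<eta> = 1 \<Longrightarrow> norm \<xi> = 1 \<Longrightarrow>
        ((\<lambda>z. K z \<eta> \<xi>) has_field_derivative N z \<eta> \<xi> / ((1 - \<eta> * z) * (1 - \<xi> * z))) (at z)"
    and N: "\<And>z \<eta> \<xi>. norm z < 1 \<Longrightarrow> norm \<eta> = 1 \<Longrightarrow> norm \<xi> = 1 \<Longrightarrow> norm (N z \<eta> \<xi>) \<le> C"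
    and meas: "\<And>z. (\<lambda>(\<eta>, \<xi>). K z \<eta> \<xi>) \<in> borel_measurable (borel \<Otimes>\<^sub>M borel)"
    and z: "norm z < 1"
  shows "((\<lambda>z. LINT \<xi>|\<kappa>. LINT \<eta>|\<delta>. K z \<eta> \<xi>) has_field_derivative
          (LINT \<xi>|\<kappa>. LINT \<eta>|\<delta>. N z \<eta> \<xi> / ((1 - \<eta> * z) * (1 - \<xi> * z)))) (at z)"
proof -
  interpret \<delta>: prob_space \<delta> by (rule circle_prob_measureD[OF \<delta>])
  interpret \<kappa>: prob_space \<kappa> by (rule circle_prob_measureD[OF \<kappa>])
  interpret pair_prob_space \<delta> \<kappa> ..
  let ?k = "\<lambda>z \<eta> \<xi>. N z \<eta> \<xi> / ((1 - \<eta> * z) * (1 - \<xi> * z))"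
  have C: "0 \<le> C" by (rule order_trans[OF norm_ge_zero N[of 0 1 1]]) simp_all
  have k_bound: "norm (?k w \<eta> \<xi>) \<le> C / (1 - r)\<^sup>2"
    if "norm w \<le> r" "r < 1" "norm \<eta> = 1" "norm \<xi> = 1" for r w \<eta> \<xi>
  proof -
    have "1 - r \<le> norm (1 - \<eta> * w)" "1 - r \<le> norm (1 - \<xi> * w)"
      using unit_circle_factor_bound[of \<eta> w] unit_circle_factor_bound[of \<xi> w] that by auto
    then have "(1 - r) * (1 - r) \<le> norm (1 - \<eta> * w) * norm (1 - \<xi> * w)"
      using that by (intro mult_mono) auto
    with N[of w \<eta> \<xi>] that C show ?thesis
      by (auto simp: norm_divide norm_mult power2_eq_square intro!: frac_le)
  qed
  have K_bound: "norm (K w \<eta> \<xi>) \<le> C / (1 - norm w)\<^sup>2"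
    if "norm w < 1" "norm \<eta> = 1" "norm \<xi> = 1" for w \<eta> \<xi>
  proof -
    have "norm (K w \<eta> \<xi> - K 0 \<eta> \<xi>) \<le> C / (1 - norm w)\<^sup>2 * norm (w - 0)"
      by (rule field_differentiable_bound[of "cball 0 (norm w)" "\<lambda>w. K w \<eta> \<xi>" "\<lambda>w. ?k w \<eta> \<xi>"])
         (use that in \<open>auto intro!: k_bound has_field_derivative_at_within[OF deriv]\<close>)
    also have "\<dots> \<le> C / (1 - norm w)\<^sup>2 * 1"
      using that C by (intro mult_left_mono) auto
    finally show ?thesis by (simp add: K0)
  qed
  have space: "space (\<delta> \<Otimes>\<^sub>M \<kappa>) = sphere 0 1 \<times> sphere 0 1"
    by (simp add: space_pair_measure circle_prob_measureD[OF \<delta>] circle_prob_measureD[OF \<kappa>])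
  have "(\<lambda>p. (fst p, snd p)) \<in> measurable (\<delta> \<Otimes>\<^sub>M \<kappa>) (borel \<Otimes>\<^sub>M borel)"
    by (intro measurable_Pair measurable_compose[OF measurable_fst circle_prob_measureD(3)[OF \<delta>]]
        measurable_compose[OF measurable_snd circle_prob_measureD(3)[OF \<kappa>]])
  from measurable_compose[OF this meas]
  have K_meas: "(\<lambda>(\<eta>, \<xi>). K w \<eta> \<xi>) \<in> borel_measurable (\<delta> \<Otimes>\<^sub>M \<kappa>)" for w
    by (simp add: case_prod_unfold)
  have K_int: "integrable (\<delta> \<Otimes>\<^sub>M \<kappa>) (\<lambda>(\<eta>, \<xi>). K w \<eta> \<xi>)" if "norm w < 1" for w
    by (rule P.integrable_const_bound[OF _ K_meas, where B = "C / (1 - norm w)\<^sup>2"])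
       (use that in \<open>auto simp: space intro!: AE_I2 K_bound\<close>)
  \<comment> \<open>the ball around \<open>z\<close> of half the distance to the circle, so that the bound is uniform on it\<close>
  define e where "e = (1 - norm z) / 2"
  have e: "e > 0" using z by (simp add: e_def)
  have near: "norm w \<le> 1 - e" "norm w < 1" if "w \<in> ball z e" for w
    using that norm_triangle_ineq2[of w z] z by (auto simp: e_def dist_norm norm_minus_commute field_simps)
  have "integrable (\<delta> \<Otimes>\<^sub>M \<kappa>) (\<lambda>(\<eta>, \<xi>). ?k z \<eta> \<xi>)" (is ?I)
    and "((\<lambda>w. integral\<^sup>L (\<delta> \<Otimes>\<^sub>M \<kappa>) (\<lambda>(\<eta>, \<xi>). K w \<eta> \<xi>)) has_field_derivative
          integral\<^sup>L (\<delta> \<Otimes>\<^sub>M \<kappa>) (\<lambda>(\<eta>, \<xi>). ?k z \<eta> \<xi>)) (at z)" (is ?D)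
  proof -
    have deriv': "((\<lambda>w. case x of (\<eta>, \<xi>) \<Rightarrow> K w \<eta> \<xi>) has_field_derivative (case x of (\<eta>, \<xi>) \<Rightarrow> ?k w \<eta> \<xi>)) (at w)"
      if "w \<in> ball z e" "x \<in> space (\<delta> \<Otimes>\<^sub>M \<kappa>)" for w x
      using that(2) deriv[OF near(2)[OF that(1)]] by (auto simp: space)
    have bound': "norm (case x of (\<eta>, \<xi>) \<Rightarrow> ?k w \<eta> \<xi>) \<le> C / (1 - (1 - e))\<^sup>2"
      if "w \<in> ball z e" "x \<in> space (\<delta> \<Otimes>\<^sub>M \<kappa>)" for w x
      using that(2) k_bound[OF near(1)[OF that(1)]] e by (auto simp: space)
    note D = has_field_derivative_integral[where K = "\<lambda>w (\<eta>, \<xi>). K w \<eta> \<xi>" and k = "\<lambda>w (\<eta>, \<xi>). ?k w \<eta> \<xi>",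
        OF P.finite_measure_axioms e deriv' bound' K_int[OF near(2)]]
    show ?I by (rule D(1))
    show ?D by (rule D(2))
  qed
  note k_int = this(1) and D = this(2)
  show ?thesis
    unfolding integral_snd[OF k_int]
    by (rule has_field_derivative_transform_within_open[OF D, of unit_disc])
       (use z in \<open>auto simp: integral_snd[OF K_int]\<close>)
qed

text \<open>
  After multiplication by \<open>z\<close> the derivatives of \<open>K1\<close> and \<open>K2\<close> are, up to an additive constant, a
  function of \<open>\<eta>\<close> times a function of \<open>\<xi>\<close>, each affine in the Herglotz kernel \<open>p\<close>. Their double
  integrals therefore factor.
\<close>

lemma herglotz_double_integral:
  assumes \<delta>: "circle_prob_measure \<delta>" and \<kappa>: "circle_prob_measure \<kappa>" and z: "norm z < 1"
  defines "p \<equiv> \<lambda>\<eta>. (1 + \<eta> * z) / (1 - \<eta> * z)"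
  shows "(LINT \<xi>|\<kappa>. LINT \<eta>|\<delta>. (a + b * p \<eta>) * ((p \<xi> + s) / 2) - d)
     = (a + b * herglotz_integral \<delta> z) * ((herglotz_integral \<kappa> z + s) / 2) - d"
proof -
  interpret \<delta>: prob_space \<delta> by (rule circle_prob_measureD[OF \<delta>])
  interpret \<kappa>: prob_space \<kappa> by (rule circle_prob_measureD[OF \<kappa>])
  have [simp]: "integrable \<delta> p" "integrable \<kappa> p"
    unfolding p_def by (intro herglotz_kernel_integrable assms)+
  have [simp]: "(LINT \<eta>|\<delta>. p \<eta>) = herglotz_integral \<delta> z" "(LINT \<xi>|\<kappa>. p \<xi>) = herglotz_integral \<kappa> z"
    by (simp_all add: p_def herglotz_integral_def)
  show ?thesis by (simp add: \<delta>.prob_space \<kappa>.prob_space)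
qed

text \<open>
  With \<open>p\<close> and \<open>q\<close> the Herglotz integrals of \<open>\<delta>\<close> and \<open>\<kappa>\<close>, the next two lemmas identify \<open>1 + z H\<^sub>1'\<close>
  and \<open>z H\<^sub>2'\<close>, for the double integrals \<open>H\<^sub>1\<close> and \<open>H\<^sub>2\<close> of the kernels, as
  \<open>(\<alpha> + (1 - \<alpha>) p) (q + 1) / 2\<close> and \<open>(\<alpha> + (1 - \<alpha>) p) (q - 1) / 2\<close>. The derivative appears
  multiplied by \<open>z\<close>: its value at the origin depends on \<open>p'\<close> and \<open>q'\<close>, not just on \<open>p\<close> and \<open>q\<close> there.
\<close>

lemma K1_double_integral_deriv:
  assumes \<delta>: "circle_prob_measure \<delta>" and \<kappa>: "circle_prob_measure \<kappa>" and z: "norm z < 1"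
  obtains D where "((\<lambda>z. LINT \<xi>|\<kappa>. LINT \<eta>|\<delta>. K1 \<alpha> z \<eta> \<xi>) has_field_derivative D) (at z)"
    "z * D = (of_real \<alpha> + (1 - of_real \<alpha>) * herglotz_integral \<delta> z) * ((herglotz_integral \<kappa> z + 1) / 2) - 1"
proof (rule that)
  let ?N = "\<lambda>z \<eta> \<xi>. 2 * (1 - of_real \<alpha>) * \<eta> + \<xi> - \<eta> * \<xi> * z :: complex"
  let ?p = "\<lambda>\<eta>. (1 + \<eta> * z) / (1 - \<eta> * z)"
  have N: "norm (?N z \<eta> \<xi>) \<le> norm (2 * (1 - of_real \<alpha>) :: complex) + 2"
    if "norm z < 1" "norm \<eta> = 1" "norm \<xi> = 1" for z \<eta> \<xi>
  proof -
    have "norm (?N z \<eta> \<xi>) \<le> norm (2 * (1 - of_real \<alpha>) * \<eta>) + norm \<xi> + norm (\<eta> * \<xi> * z)"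
      by (rule order_trans[OF norm_triangle_ineq4 add_right_mono[OF norm_triangle_ineq]])
    then show ?thesis using that by (simp add: norm_mult)
  qed
  show "((\<lambda>z. LINT \<xi>|\<kappa>. LINT \<eta>|\<delta>. K1 \<alpha> z \<eta> \<xi>) has_field_derivative
      (LINT \<xi>|\<kappa>. LINT \<eta>|\<delta>. ?N z \<eta> \<xi> / ((1 - \<eta> * z) * (1 - \<xi> * z)))) (at z)"
    by (rule has_field_derivative_double_integral[OF \<delta> \<kappa> _ has_field_derivative_K1 N kernel_measurable(1) z])
       (auto simp: kernels_at_0)
  have "z * (?N z \<eta> \<xi> / ((1 - \<eta> * z) * (1 - \<xi> * z)))
      = (of_real \<alpha> + (1 - of_real \<alpha>) * ?p \<eta>) * ((?p \<xi> + 1) / 2) - 1"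
    if "norm \<eta> = 1" "norm \<xi> = 1" for \<eta> \<xi>
    using unit_circle_factor_nonzero[OF that(1) z] unit_circle_factor_nonzero[OF that(2) z]
    by (simp add: divide_simps) (simp add: algebra_simps)
  then show "z * (LINT \<xi>|\<kappa>. LINT \<eta>|\<delta>. ?N z \<eta> \<xi> / ((1 - \<eta> * z) * (1 - \<xi> * z)))
      = (of_real \<alpha> + (1 - of_real \<alpha>) * herglotz_integral \<delta> z) * ((herglotz_integral \<kappa> z + 1) / 2) - 1"
    unfolding herglotz_double_integral[OF \<delta> \<kappa> z, symmetric] integral_mult_right_zero[symmetric]
    by (intro Bochner_Integration.integral_cong refl)
       (simp add: circle_prob_measureD(2)[OF \<delta>] circle_prob_measureD(2)[OF \<kappa>])
qed

lemma K2_double_integral_deriv: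
  assumes \<delta>: "circle_prob_measure \<delta>" and \<kappa>: "circle_prob_measure \<kappa>" and z: "norm z < 1"
  obtains D where "((\<lambda>z. LINT \<xi>|\<kappa>. LINT \<eta>|\<delta>. K2 \<alpha> z \<eta> \<xi>) has_field_derivative D) (at z)"
    "z * D = (of_real \<alpha> + (1 - of_real \<alpha>) * herglotz_integral \<delta> z) * ((herglotz_integral \<kappa> z - 1) / 2)"
proof (rule that)
  let ?N = "\<lambda>z \<eta> \<xi>. \<xi> + (1 - 2 * of_real \<alpha>) * \<eta> * \<xi> * z :: complex"
  let ?p = "\<lambda>\<eta>. (1 + \<eta> * z) / (1 - \<eta> * z)"
  have N: "norm (?N z \<eta> \<xi>) \<le> 1 + norm (1 - 2 * of_real \<alpha> :: complex)"
    if "norm z < 1" "norm \<eta> = 1" "norm \<xi> = 1" for z \<eta> \<xi>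
  proof -
    have "norm (?N z \<eta> \<xi>) \<le> norm \<xi> + norm ((1 - 2 * of_real \<alpha>) * \<eta> * \<xi> * z)"
      by (rule norm_triangle_ineq)
    also have "\<dots> = 1 + norm (1 - 2 * of_real \<alpha> :: complex) * norm z"
      using that by (simp add: norm_mult)
    also have "\<dots> \<le> 1 + norm (1 - 2 * of_real \<alpha> :: complex)"
      using that by (simp add: mult_left_le)
    finally show ?thesis .
  qed
  show "((\<lambda>z. LINT \<xi>|\<kappa>. LINT \<eta>|\<delta>. K2 \<alpha> z \<eta> \<xi>) has_field_derivative
      (LINT \<xi>|\<kappa>. LINT \<eta>|\<delta>. ?N z \<eta> \<xi> / ((1 - \<eta> * z) * (1 - \<xi> * z)))) (at z)"
    by (rule has_field_derivative_double_integral[OF \<delta> \<kappa> _ has_field_derivative_K2 N kernel_measurable(2) z])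
       (auto simp: kernels_at_0)
  have "z * (?N z \<eta> \<xi> / ((1 - \<eta> * z) * (1 - \<xi> * z)))
      = (of_real \<alpha> + (1 - of_real \<alpha>) * ?p \<eta>) * ((?p \<xi> + - 1) / 2) - 0"
    if "norm \<eta> = 1" "norm \<xi> = 1" for \<eta> \<xi>
    using unit_circle_factor_nonzero[OF that(1) z] unit_circle_factor_nonzero[OF that(2) z]
    by (simp add: divide_simps) (simp add: algebra_simps)
  then have "z * (LINT \<xi>|\<kappa>. LINT \<eta>|\<delta>. ?N z \<eta> \<xi> / ((1 - \<eta> * z) * (1 - \<xi> * z)))
      = (of_real \<alpha> + (1 - of_real \<alpha>) * herglotz_integral \<delta> z) * ((herglotz_integral \<kappa> z + - 1) / 2) - 0"
    unfolding herglotz_double_integral[OF \<delta> \<kappa> z, symmetric] integral_mult_right_zero[symmetric]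
    by (intro Bochner_Integration.integral_cong refl)
       (simp only: circle_prob_measureD(2)[OF \<delta>] circle_prob_measureD(2)[OF \<kappa>] sphere_def mem_Collect_eq dist_0_norm)
  then show "z * (LINT \<xi>|\<kappa>. LINT \<eta>|\<delta>. ?N z \<eta> \<xi> / ((1 - \<eta> * z) * (1 - \<xi> * z)))
      = (of_real \<alpha> + (1 - of_real \<alpha>) * herglotz_integral \<delta> z) * ((herglotz_integral \<kappa> z - 1) / 2)"
    by simp
qed

section \<open>Univalence\<close>

lemma has_real_derivative_Re_Im_comp:
  fixes w :: "real \<Rightarrow> complex"
  assumes "(w has_vector_derivative w') (at x)" "(F has_field_derivative d) (at (w x))"
  shows "((\<lambda>x. Re (F (w x))) has_real_derivative Re (d * w')) (at x)"
    and "((\<lambda>x. Im (F (w x))) has_real_derivative Im (d * w')) (at x)"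
  using field_vector_diff_chain_at[OF assms]
  by (simp_all only: has_vector_derivative_complex_iff o_def mult.commute[of d])

text \<open>
  Since \<open>Re (F')\<close> is positive, \<open>Im F\<close> increases strictly on every vertical line, and by periodicity
  it runs from \<open>-\<infinity>\<close> to \<open>\<infinity>\<close> there. So each level set \<open>Im F = c\<close> is the graph of a function \<open>Y\<close>
  over the whole half line \<open>x < 0\<close>. Its tangent at a point is the direction in which \<open>F\<close> has a real
  derivative, that is, a multiple of \<open>1 / F'\<close>, normalised to have real part \<open>1\<close>.
\<close>

lemma level_curve:
  fixes F :: "complex \<Rightarrow> complex"
  assumes hol: "F holomorphic_on {w. Re w < 0}"
    and period: "\<And>w n. Re w < 0 \<Longrightarrow> F (w + of_int n * (2 * of_real pi * \<i>)) = F w + of_int n * (2 * of_real pi * \<i>)"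
    and pos: "\<And>w. Re w < 0 \<Longrightarrow> Re (deriv F w) > 0"
  obtains Y :: "real \<Rightarrow> real"
  where "\<And>x y. x < 0 \<Longrightarrow> Im (F (Complex x y)) = c \<longleftrightarrow> y = Y x"
    and "\<And>x. x < 0 \<Longrightarrow> ((\<lambda>x. Complex x (Y x)) has_vector_derivative
           inverse (deriv F (Complex x (Y x))) / of_real (Re (inverse (deriv F (Complex x (Y x)))))) (at x)"
proof -
  have openH: "open {w. Re w < 0}" by (rule open_halfspace_Re_lt)
  have dF: "(F has_field_derivative deriv F w) (at w)" if "Re w < 0" for w
    using holomorphic_derivI[OF hol openH] that by simp
  have isCont_F: "isCont F w" if "Re w < 0" for w
    using dF[OF that] by (rule DERIV_isCont)
  have cont_Complex: "isCont (Complex x) y" "isCont (\<lambda>x. Complex x y) x" for x y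
    unfolding isCont_def by (intro tendsto_Complex tendsto_const tendsto_ident_at)+
  have increasing: "Im (F (Complex x y)) < Im (F (Complex x y'))" if x: "x < 0" and "y < y'" for x y y'
  proof (rule DERIV_pos_imp_increasing[OF \<open>y < y'\<close>])
    fix t
    have "((\<lambda>y. Complex x y) has_vector_derivative \<i>) (at t)"
      by (simp add: has_vector_derivative_complex_iff)
    from has_real_derivative_Re_Im_comp(2)[OF this dF]
    have "((\<lambda>y. Im (F (Complex x y))) has_real_derivative Re (deriv F (Complex x t))) (at t)"
      using x by simp
    then show "\<exists>d. ((\<lambda>y. Im (F (Complex x y))) has_real_derivative d) (at t) \<and> 0 < d"
      using pos[of "Complex x t"] x by auto
  qed
  have ex: "\<exists>y. Im (F (Complex x y)) = c" if x: "x < 0" for x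
  proof -
    have shift: "Im (F (Complex x (of_int n * (2 * pi)))) = Im (F (of_real x)) + of_int n * (2 * pi)" for n
    proof -
      have "Complex x (of_int n * (2 * pi)) = of_real x + of_int n * (2 * of_real pi * \<i>)"
        by (simp add: complex_eq_iff)
      then show ?thesis using period[of "of_real x" n] x by simp
    qed
    define m where "m = c - Im (F (of_real x))"
    \<comment> \<open>far enough by periods in both directions for the intermediate value theorem\<close>
    obtain n :: nat where n: "\<bar>m\<bar> \<le> n" using real_arch_simple by blast
    have "real n * 1 \<le> real n * (2 * pi)" using pi_gt3 by (intro mult_left_mono) auto
    then have "\<bar>m\<bar> \<le> real n * (2 * pi)" using n by linarith
    then have "Im (F (Complex x (of_int (- int n) * (2 * pi)))) \<le> c" "c \<le> Im (F (Complex x (of_int (int n) * (2 * pi))))"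
      unfolding shift by (auto simp: m_def abs_le_iff)
    moreover have "continuous_on S (\<lambda>y. Im (F (Complex x y)))" for S
      using x by (intro continuous_at_imp_continuous_on ballI isCont_o2[OF _ isCont_o2[OF isCont_F]])
         (auto intro: cont_Complex)
    ultimately have "\<exists>y\<ge>of_int (- int n) * (2 * pi). y \<le> of_int (int n) * (2 * pi) \<and> Im (F (Complex x y)) = c"
      by (intro IVT') auto
    then show ?thesis by blast
  qed
  then obtain Y where Y: "\<And>x. x < 0 \<Longrightarrow> Im (F (Complex x (Y x))) = c" by metis
  have Y_unique: "Im (F (Complex x y)) = c \<longleftrightarrow> y = Y x" if "x < 0" for x y
    using increasing[OF that, of y "Y x"] increasing[OF that, of "Y x" y] Y[OF that]
    by (cases y "Y x" rule: linorder_cases) auto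
  have Y_cont: "Y \<midarrow>x0\<rightarrow> Y x0" if x0: "x0 < 0" for x0
  proof (rule tendstoI)
    fix \<epsilon> :: real assume \<epsilon>: "\<epsilon> > 0"
    have lim: "((\<lambda>x. Im (F (Complex x y))) \<longlongrightarrow> Im (F (Complex x0 y))) (at x0)" for y
    proof -
      have "isCont (\<lambda>x. Im (F (Complex x y))) x0"
        using x0 by (intro isCont_o2[OF _ isCont_o2[OF isCont_F]]) (auto intro: cont_Complex)
      then show ?thesis by (simp add: isCont_def)
    qed
    have neg: "eventually (\<lambda>x. x < 0) (at x0)"
      by (rule order_tendstoD(2)[OF tendsto_ident_at x0])
    have "eventually (\<lambda>x. Im (F (Complex x (Y x0 - \<epsilon>))) < c) (at x0)"
      using increasing[OF x0, of "Y x0 - \<epsilon>" "Y x0"] \<epsilon> Y[OF x0] by (intro order_tendstoD(2)[OF lim]) simp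
    moreover have "eventually (\<lambda>x. c < Im (F (Complex x (Y x0 + \<epsilon>)))) (at x0)"
      using increasing[OF x0, of "Y x0" "Y x0 + \<epsilon>"] \<epsilon> Y[OF x0] by (intro order_tendstoD(1)[OF lim]) simp
    ultimately show "eventually (\<lambda>x. dist (Y x) (Y x0) < \<epsilon>) (at x0)"
      using neg
    proof eventually_elim
      case (elim x)
      have "Y x0 - \<epsilon> < Y x"
        using increasing[of x "Y x" "Y x0 - \<epsilon>"] Y[of x] elim
        by (cases "Y x" "Y x0 - \<epsilon>" rule: linorder_cases) auto
      moreover have "Y x < Y x0 + \<epsilon>"
        using increasing[of x "Y x0 + \<epsilon>" "Y x"] Y[of x] elim
        by (cases "Y x" "Y x0 + \<epsilon>" rule: linorder_cases) auto
      ultimately show ?case by (auto simp: dist_real_def)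
    qed
  qed
  have deriv: "((\<lambda>x. Complex x (Y x)) has_vector_derivative
      inverse (deriv F (Complex x0 (Y x0))) / of_real (Re (inverse (deriv F (Complex x0 (Y x0)))))) (at x0)"
    if x0: "x0 < 0" for x0
  proof -
    define W where "W x = Complex x (Y x)" for x
    define d where "d = deriv F (W x0)"
    have Re_d: "Re d > 0" unfolding d_def using pos x0 by (simp add: W_def)
    then have d: "d \<noteq> 0" "Re (inverse d) \<noteq> 0"
      by (auto simp: complex_eq_iff add_nonneg_eq_0_iff)
    have W_lim: "W \<midarrow>x0\<rightarrow> W x0"
      unfolding W_def by (intro tendsto_Complex tendsto_ident_at Y_cont x0)
    have W_ne: "W x \<noteq> W x0" if "x \<noteq> x0" for x using that by (simp add: W_def)
    \<comment> \<open>On the curve the increment of \<open>F\<close> is a real number \<open>t\<close>, and \<open>W x - W x0 = t / q x\<close> has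
        real part \<open>x - x0\<close>. This determines \<open>t\<close>, and hence the difference quotient of \<open>W\<close>,
        in terms of \<open>q x\<close>, whose limit is known.\<close>
    define q where "q x = (F (W x) - F (W x0)) / (W x - W x0)" for x
    have "filterlim W (at (W x0)) (at x0)"
      using W_lim W_ne by (auto simp: filterlim_at eventually_at_filter)
    moreover have "((\<lambda>w. (F w - F (W x0)) / (w - W x0)) \<longlongrightarrow> d) (at (W x0))"
      using dF[of "W x0"] x0 unfolding has_field_derivative_iff d_def by (simp add: W_def)
    ultimately have q_lim: "(q \<longlongrightarrow> d) (at x0)"
      unfolding q_def by (rule filterlim_compose[rotated])
    have "((\<lambda>x. inverse (q x) / of_real (Re (inverse (q x)))) \<longlongrightarrow> inverse d / of_real (Re (inverse d))) (at x0)"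
    proof -
      have "complex_of_real (Re (inverse d)) \<noteq> 0" unfolding of_real_eq_0_iff by (rule d(2))
      then show ?thesis by (intro tendsto_divide tendsto_inverse tendsto_of_real tendsto_Re q_lim d(1))
    qed
    moreover have "eventually (\<lambda>x. inverse (q x) / of_real (Re (inverse (q x))) = (1 / (x - x0)) *\<^sub>R (W x - W x0)) (at x0)"
      using tendsto_imp_eventually_ne[OF q_lim d(1)] order_tendstoD(2)[OF tendsto_ident_at x0]
        eventually_neq_at_within[of x0]
    proof eventually_elim
      case (elim x)
      define t where "t = Re (F (W x)) - Re (F (W x0))"
      have "F (W x) - F (W x0) = of_real t"
        using Y[of x] Y[of x0] x0 elim by (simp add: complex_eq_iff t_def W_def)
      then have q_eq: "q x = of_real t / (W x - W x0)" by (simp add: q_def)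
      then have t: "t \<noteq> 0" using elim by auto
      have inv: "inverse (q x) = (W x - W x0) / of_real t" by (simp add: q_eq)
      have Re_inv: "Re (inverse (q x)) = (x - x0) / t" unfolding inv by (simp add: W_def)
      show ?case unfolding Re_inv unfolding inv using t elim by (simp add: scaleR_conv_of_real)
    qed
    ultimately have "((\<lambda>x. (1 / (x - x0)) *\<^sub>R (W x - W x0)) \<longlongrightarrow> inverse d / of_real (Re (inverse d))) (at x0)"
      by (rule Lim_transform_eventually)
    from tendsto_Im[OF this]
    have "(Y has_real_derivative Im (inverse d / of_real (Re (inverse d)))) (at x0)"
      by (simp add: has_field_derivative_iff W_def divide_inverse mult.commute)
    moreover have "Re (inverse d / of_real (Re (inverse d))) = 1"
      unfolding Re_divide_of_real using d by simp
    ultimately show ?thesis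
      unfolding has_vector_derivative_complex_iff d_def W_def by simp
  qed
  show ?thesis using Y_unique deriv by (rule that)
qed

text \<open>
  Adding the real number \<open>2 Re (L w)\<close> leaves the imaginary part of \<open>F\<close> unchanged, so two points
  with the same image lie on one level curve of \<open>Im F\<close>. Along that curve \<open>dF\<close> is a positive multiple
  \<open>\<rho>\<close> of \<open>dx\<close> and \<open>dL = (L' / F') dF\<close>, so \<open>Re (F + 2 L)\<close> has derivative
  \<open>\<rho> Re (1 + 2 L' / F')\<close>, which is positive. Hence the points coincide.
\<close>

lemma log_coordinates_injective:
  fixes F L :: "complex \<Rightarrow> complex"
  assumes F: "F holomorphic_on {w. Re w < 0}" and L: "L holomorphic_on {w. Re w < 0}"
    and period: "\<And>w n. Re w < 0 \<Longrightarrow> F (w + of_int n * (2 * of_real pi * \<i>)) = F w + of_int n * (2 * of_real pi * \<i>)"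
    and pos: "\<And>w. Re w < 0 \<Longrightarrow> Re (deriv F w) > 0"
    and pos': "\<And>w. Re w < 0 \<Longrightarrow> Re (1 + 2 * deriv L w / deriv F w) > 0"
    and w: "Re w1 < 0" "Re w2 < 0"
    and eq: "F w1 + 2 * of_real (Re (L w1)) = F w2 + 2 * of_real (Re (L w2))"
  shows "w1 = w2"
proof -
  obtain Y where Y: "\<And>x y. x < 0 \<Longrightarrow> Im (F (Complex x y)) = Im (F w1) \<longleftrightarrow> y = Y x"
    and dY: "\<And>x. x < 0 \<Longrightarrow> ((\<lambda>x. Complex x (Y x)) has_vector_derivative
           inverse (deriv F (Complex x (Y x))) / of_real (Re (inverse (deriv F (Complex x (Y x)))))) (at x)"
    using level_curve[OF F period pos] by blast
  have openH: "open {w. Re w < 0}" by (rule open_halfspace_Re_lt)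
  define M where "M x = Re (F (Complex x (Y x))) + 2 * Re (L (Complex x (Y x)))" for x
  have M_deriv: "\<exists>m. (M has_real_derivative m) (at x) \<and> 0 < m" if x: "x < 0" for x
  proof -
    let ?w = "Complex x (Y x)"
    define \<rho> where "\<rho> = 1 / Re (inverse (deriv F ?w))"
    have Re_d: "Re (deriv F ?w) > 0" using pos x by simp
    then have d: "deriv F ?w \<noteq> 0" by auto
    have \<rho>: "\<rho> > 0" using Re_d unfolding \<rho>_def by (simp add: sum_power2_gt_zero_iff)
    have dw: "((\<lambda>x. Complex x (Y x)) has_vector_derivative inverse (deriv F ?w) * of_real \<rho>) (at x)"
      using dY[OF x] by (simp add: \<rho>_def divide_inverse)
    have "(F has_field_derivative deriv F ?w) (at ?w)" "(L has_field_derivative deriv L ?w) (at ?w)"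
      using holomorphic_derivI[OF F openH] holomorphic_derivI[OF L openH] x by auto
    from this[THEN has_real_derivative_Re_Im_comp(1)[OF dw]]
    have "(M has_real_derivative (Re (deriv F ?w * (inverse (deriv F ?w) * of_real \<rho>))
        + 2 * Re (deriv L ?w * (inverse (deriv F ?w) * of_real \<rho>)))) (at x)"
      unfolding M_def by (intro DERIV_add DERIV_cmult)
    moreover have "Re (deriv F ?w * (inverse (deriv F ?w) * of_real \<rho>))
        + 2 * Re (deriv L ?w * (inverse (deriv F ?w) * of_real \<rho>)) = \<rho> * Re (1 + 2 * deriv L ?w / deriv F ?w)"
    proof -
      have "deriv F ?w * (inverse (deriv F ?w) * of_real \<rho>) = of_real \<rho>" using d by simp
      moreover have "deriv L ?w * (inverse (deriv F ?w) * of_real \<rho>) = of_real \<rho> * (deriv L ?w / deriv F ?w)"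
        by (simp add: divide_inverse mult_ac)
      moreover have "2 * deriv L ?w / deriv F ?w = of_real 2 * (deriv L ?w / deriv F ?w)" by simp
      moreover have "Re (1 + of_real 2 * w) = 1 + 2 * Re w" "Re (of_real \<rho> * w) = \<rho> * Re w" for w
        by (simp_all del: of_real_numeral)
      ultimately show ?thesis by (simp only: Re_complex_of_real) (simp only: algebra_simps)
    qed
    moreover have "\<rho> * Re (1 + 2 * deriv L ?w / deriv F ?w) > 0"
      using \<rho> pos'[of ?w] x by simp
    ultimately show ?thesis by auto
  qed
  have M_mono: "M x < M x'" if "x < x'" "x' < 0" for x x'
    by (rule DERIV_pos_imp_increasing[OF that(1)]) (use that in \<open>auto intro: M_deriv\<close>)
  have on_curve: "Complex (Re w1) (Y (Re w1)) = w1" "Complex (Re w2) (Y (Re w2)) = w2"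
  proof -
    have "Im (F w2) = Im (F w1)" using arg_cong[OF eq, of Im] by simp
    then show "Complex (Re w1) (Y (Re w1)) = w1" "Complex (Re w2) (Y (Re w2)) = w2"
      using Y[of "Re w1" "Im w1"] Y[of "Re w2" "Im w2"] w by (simp_all add: complex_eq_iff)
  qed
  have "M (Re w1) = M (Re w2)"
    unfolding M_def on_curve using arg_cong[OF eq, of Re] by simp
  then have "Re w1 = Re w2"
    using M_mono[of "Re w1" "Re w2"] M_mono[of "Re w2" "Re w1"] w
    by (cases "Re w1" "Re w2" rule: linorder_cases) auto
  then show ?thesis using on_curve by metis
qed

text \<open>
  In the coordinate \<open>w = log z\<close> the punctured disc becomes the left half plane, and the map has the
  logarithm \<open>F w + 2 Re (L w)\<close> with \<open>F w = w + a (exp w) - b (exp w)\<close>, \<open>L w = b (exp w)\<close>. Here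
  \<open>exp F = z exp a / exp b\<close> is the analytic starlike function with the same argument as the map.
\<close>

lemma log_harmonic_injective:
  fixes a b :: "complex \<Rightarrow> complex"
  assumes a: "a holomorphic_on unit_disc" and b: "b holomorphic_on unit_disc"
    and pos: "\<And>z. z \<in> unit_disc \<Longrightarrow> Re (1 + z * deriv a z - z * deriv b z) > 0"
    and pos': "\<And>z. z \<in> unit_disc \<Longrightarrow> Re (1 + 2 * (z * deriv b z) / (1 + z * deriv a z - z * deriv b z)) > 0"
  shows "inj_on (\<lambda>z. z * exp (a z) * cnj (exp (b z))) unit_disc"
proof (rule inj_onI)
  fix z1 z2
  assume z: "z1 \<in> unit_disc" "z2 \<in> unit_disc"
    and eq: "z1 * exp (a z1) * cnj (exp (b z1)) = z2 * exp (a z2) * cnj (exp (b z2))"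
  show "z1 = z2"
  proof (cases "z1 = 0 \<or> z2 = 0")
    case True
    then show ?thesis using eq by auto
  next
    case False
    define F where "F w = w + a (exp w) - b (exp w)" for w
    define L where "L w = b (exp w)" for w
    have exp_disc: "exp w \<in> unit_disc" if "Re w < 0" for w :: complex using that by simp
    have dF: "(F has_field_derivative 1 + exp w * deriv a (exp w) - exp w * deriv b (exp w)) (at w)"
      and dL: "(L has_field_derivative exp w * deriv b (exp w)) (at w)" if w: "Re w < 0" for w
    proof -
      have da: "((\<lambda>w. a (exp w)) has_field_derivative deriv a (exp w) * exp w) (at w)"
        by (rule DERIV_chain2[OF holomorphic_derivI[OF a open_ball exp_disc[OF w]] DERIV_exp])
      have db: "((\<lambda>w. b (exp w)) has_field_derivative deriv b (exp w) * exp w) (at w)"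
        by (rule DERIV_chain2[OF holomorphic_derivI[OF b open_ball exp_disc[OF w]] DERIV_exp])
      show "(L has_field_derivative exp w * deriv b (exp w)) (at w)"
        unfolding L_def using db by (simp add: mult.commute)
      show "(F has_field_derivative 1 + exp w * deriv a (exp w) - exp w * deriv b (exp w)) (at w)"
        unfolding F_def using DERIV_diff[OF DERIV_add[OF DERIV_ident da] db] by (simp add: mult.commute)
    qed
    note derivs = DERIV_imp_deriv[OF dF] DERIV_imp_deriv[OF dL]
    have openH: "open {w. Re w < 0}" by (rule open_halfspace_Re_lt)
    have hol: "F holomorphic_on {w. Re w < 0}" "L holomorphic_on {w. Re w < 0}"
      using dF dL by (auto simp: holomorphic_on_open[OF openH])
    have exp_period: "exp (w + of_int n * (2 * of_real pi * \<i>)) = exp w" for w :: complex and n :: int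
      by (rule exp_eq[THEN iffD2], rule exI[of _ n]) simp
    define \<Phi> where "\<Phi> w = F w + 2 * of_real (Re (L w))" for w
    have exp_\<Phi>: "exp (\<Phi> w) = exp w * exp (a (exp w)) * cnj (exp (b (exp w)))" for w
    proof -
      have "\<Phi> w = w + a (exp w) + cnj (b (exp w))"
        by (simp add: \<Phi>_def F_def L_def complex_eq_iff)
      then show ?thesis by (simp add: exp_add exp_cnj)
    qed
    have period: "F (w + of_int n * (2 * of_real pi * \<i>)) = F w + of_int n * (2 * of_real pi * \<i>)"
      "\<Phi> (w + of_int n * (2 * of_real pi * \<i>)) = \<Phi> w + of_int n * (2 * of_real pi * \<i>)" for w n
      unfolding \<Phi>_def F_def L_def exp_period by simp_all
    have Re_Ln: "Re (Ln z1) < 0" "Re (Ln z2) < 0" using z False by simp_all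
    have "exp (\<Phi> (Ln z1)) = exp (\<Phi> (Ln z2))" using eq False by (simp add: exp_\<Phi>)
    then obtain n :: int where "\<Phi> (Ln z1) = \<Phi> (Ln z2) + of_int n * (2 * of_real pi * \<i>)"
      by (auto simp: exp_eq mult_ac)
    then have "\<Phi> (Ln z1) = \<Phi> (Ln z2 + of_int n * (2 * of_real pi * \<i>))" by (simp add: period)
    then have "F (Ln z1) + 2 * of_real (Re (L (Ln z1))) = F (Ln z2 + of_int n * (2 * of_real pi * \<i>))
        + 2 * of_real (Re (L (Ln z2 + of_int n * (2 * of_real pi * \<i>))))"
      by (simp only: \<Phi>_def)
    from log_coordinates_injective[OF hol period(1) _ _ _ _ this]
    have "Ln z1 = Ln z2 + of_int n * (2 * of_real pi * \<i>)"
      using Re_Ln pos[OF exp_disc] pos'[OF exp_disc] by (simp add: derivs)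
    then have "exp (Ln z1) = exp (Ln z2)" by (simp add: exp_period)
    then show ?thesis using False by simp
  qed
qed

section \<open>Log-harmonic mappings and the characterisation\<close>

lemma exp_power_series_logarithm:
  assumes "exp_power_series h"
  obtains a where "a holomorphic_on unit_disc" "a 0 = 0" "\<And>z. z \<in> unit_disc \<Longrightarrow> h z = exp (a z)"
proof -
  obtain c :: "nat \<Rightarrow> complex" where c: "\<forall>z\<in>unit_disc. summable (\<lambda>n. c (Suc n) * z ^ Suc n)
      \<and> h z = exp (\<Sum>n. c (Suc n) * z ^ Suc n)"
    using assms unfolding exp_power_series_def by (elim exE) (rule that)
  define a where "a z = (\<Sum>n. c (Suc n) * z ^ Suc n)" for z
  have "(\<lambda>n. (if n = 0 then 0 else c n) * (z - 0) ^ n) sums a z" if "z \<in> unit_disc" for z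
  proof -
    have "(\<lambda>n. (if Suc n = 0 then 0 else c (Suc n)) * (z - 0) ^ Suc n) sums a z"
      using c that unfolding a_def by (simp add: summable_sums)
    from sums_Suc[where f = "\<lambda>n. (if n = 0 then 0 else c n) * (z - 0) ^ n", OF this] show ?thesis by simp
  qed
  then have "a holomorphic_on unit_disc" by (rule power_series_holomorphic)
  moreover have "a 0 = 0" by (simp add: a_def)
  moreover have "h z = exp (a z)" if "z \<in> unit_disc" for z using c that by (simp add: a_def)
  ultimately show ?thesis by (rule that)
qed

text \<open>
  The logarithm of \<open>f\<close> is the sum of the analytic \<open>log z + a z\<close> and the antianalytic \<open>cnj (b z)\<close>;
  the two Wirtinger derivatives see one summand each.
\<close>

lemma Wirtinger_log_harmonic:
  assumes a: "a holomorphic_on unit_disc" and b: "b holomorphic_on unit_disc"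
    and f: "\<And>z. z \<in> unit_disc \<Longrightarrow> f z = z * exp (a z) * cnj (exp (b z))"
    and z: "z \<in> unit_disc" "z \<noteq> 0"
  shows "deriv_z f z / f z = (1 + z * deriv a z) / z"
    and "deriv_zbar f z / f z = cnj (deriv b z)"
proof -
  have da: "(a has_field_derivative deriv a z) (at z)" and db: "(b has_field_derivative deriv b z) (at z)"
    using holomorphic_derivI[OF a open_ball z(1)] holomorphic_derivI[OF b open_ball z(1)] .
  let ?u = "\<lambda>z. z * exp (a z)" and ?v = "\<lambda>z. exp (b z)"
  have du: "(?u has_derivative (*) (exp (a z) * (1 + z * deriv a z))) (at z)"
    using da unfolding has_field_derivative_def[symmetric]
    by (auto intro!: derivative_eq_intros simp: algebra_simps)
  have "(?v has_derivative (*) (exp (b z) * deriv b z)) (at z)"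
    using db unfolding has_field_derivative_def[symmetric]
    by (auto intro!: derivative_eq_intros)
  then have dv: "((\<lambda>z. cnj (?v z)) has_derivative (\<lambda>t. cnj (exp (b z) * deriv b z * t))) (at z)"
    by (rule bounded_linear.has_derivative[OF bounded_linear_cnj])
  have f0: "f z \<noteq> 0" using f[OF z(1)] z by simp
  have "((\<lambda>z. ?u z * cnj (?v z)) has_derivative
      (\<lambda>t. f z * ((1 + z * deriv a z) / z * t + cnj (deriv b z * t)))) (at z)"
    by (rule has_derivative_eq_rhs[OF has_derivative_mult[OF du dv]])
       (use z in \<open>simp add: fun_eq_iff f field_simps\<close>)
  then have "(f has_derivative (\<lambda>t. f z * ((1 + z * deriv a z) / z * t + cnj (deriv b z * t)))) (at z)"
    by (rule has_derivative_transform_within_open[OF _ open_ball z(1)]) (simp add: f)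
  then have D: "frechet_derivative f (at z) = (\<lambda>t. f z * ((1 + z * deriv a z) / z * t + cnj (deriv b z * t)))"
    by (rule frechet_derivative_at[symmetric])
  have w: "(w * (p * 1 + cnj (q * 1)) - \<i> * (w * (p * \<i> + cnj (q * \<i>)))) / 2 = w * p"
    "(w * (p * 1 + cnj (q * 1)) + \<i> * (w * (p * \<i> + cnj (q * \<i>)))) / 2 = w * cnj q" for p q w :: complex
    by (simp_all add: algebra_simps)
  show "deriv_z f z / f z = (1 + z * deriv a z) / z" "deriv_zbar f z / f z = cnj (deriv b z)"
    unfolding deriv_z_def deriv_zbar_def D w using f0 by simp_all
qed

text \<open>
  With \<open>A = 1 + z a'\<close> and \<open>B = z b'\<close> the log-harmonic equation reads \<open>B = \<mu> A\<close>, and the starlikeness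
  functional is \<open>A - cnj B\<close>, whose real part is that of \<open>A - B\<close>. Univalence follows from the
  inequality, because \<open>1 + 2 B / (A - B) = (1 + \<mu>) / (1 - \<mu>)\<close> has positive real part. The
  inequality extends to the origin, where \<open>A - B = 1 > \<alpha>\<close>.
\<close>

lemma starlike_log_harmonic_iff:
  assumes \<alpha>: "0 \<le> \<alpha>" "\<alpha> < 1" and norm_f: "normalized_log_harmonic f h g"
    and a: "a holomorphic_on unit_disc" and b: "b holomorphic_on unit_disc"
    and h: "\<And>z. z \<in> unit_disc \<Longrightarrow> h z = exp (a z)" and g: "\<And>z. z \<in> unit_disc \<Longrightarrow> g z = exp (b z)"
    and A_def: "\<And>z. A z = 1 + z * deriv a z" and B_def: "\<And>z. B z = z * deriv b z"
  obtains \<mu> where "\<mu> holomorphic_on unit_disc" "\<And>z. z \<in> unit_disc \<Longrightarrow> norm (\<mu> z) < 1" "\<mu> 0 = 0"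
    "\<And>z. z \<in> unit_disc \<Longrightarrow> B z = \<mu> z * A z"
    "f \<in> starlike_log_harmonic \<alpha> \<longleftrightarrow> (\<forall>z\<in>unit_disc. Re (A z - B z) > \<alpha>)"
proof -
  obtain \<mu> where lh: "log_harmonic_with_dilatation f \<mu>" and \<mu>0: "\<mu> 0 = 0"
    and f_hg: "\<And>z. z \<in> unit_disc \<Longrightarrow> f z = z * h z * cnj (g z)"
    using norm_f unfolding normalized_log_harmonic_def by blast
  have f: "f z = z * exp (a z) * cnj (exp (b z))" if "z \<in> unit_disc" for z
    using f_hg h g that by simp
  have W: "deriv_z f z / f z = A z / z" "deriv_zbar f z / f z = cnj (deriv b z)"
    if "z \<in> unit_disc" "z \<noteq> 0" for z
    unfolding A_def by (rule Wirtinger_log_harmonic[OF a b f that], assumption)+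
  have f0: "f z \<noteq> 0" if "z \<in> unit_disc" "z \<noteq> 0" for z using f that by simp
  have \<mu>_hol: "\<mu> holomorphic_on unit_disc" and \<mu>_lt: "\<And>z. z \<in> unit_disc \<Longrightarrow> norm (\<mu> z) < 1"
    using lh by (auto simp: log_harmonic_with_dilatation_def)
  have BA: "B z = \<mu> z * A z" if z: "z \<in> unit_disc" for z
  proof (cases "z = 0")
    case False
    have "cnj (deriv_zbar f z) / cnj (f z) = \<mu> z * (deriv_z f z / f z)"
      using lh z f0[OF z False] by (auto simp: log_harmonic_with_dilatation_def)
    moreover have "cnj (deriv_zbar f z) / cnj (f z) = deriv b z"
      using arg_cong[OF W(2)[OF z False], of cnj] by simp
    ultimately have "deriv b z = \<mu> z * (A z / z)" using W(1)[OF z False] by (simp only:)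
    then show ?thesis using False by (simp add: B_def)
  qed (simp add: B_def \<mu>0)
  have Re_eq: "Re ((z * deriv_z f z - cnj z * deriv_zbar f z) / f z) = Re (A z - B z)"
    if z: "z \<in> unit_disc" "z \<noteq> 0" for z
  proof -
    have "(z * deriv_z f z - cnj z * deriv_zbar f z) / f z = z * (deriv_z f z / f z) - cnj z * (deriv_zbar f z / f z)"
      by (simp add: diff_divide_distrib)
    also have "\<dots> = A z - cnj (B z)"
      unfolding W[OF z] using z(2) by (simp add: B_def)
    finally show ?thesis by simp
  qed
  have inj: "inj_on f unit_disc" if pos: "\<And>z. z \<in> unit_disc \<Longrightarrow> Re (A z - B z) > \<alpha>"
  proof -
    have "Re (1 + 2 * B z / (A z - B z)) > 0" if z: "z \<in> unit_disc" for z
    proof -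
      have ne: "A z - B z \<noteq> 0" using pos[OF z] \<alpha> by auto
      then have "A z \<noteq> 0" "1 - \<mu> z \<noteq> 0" using BA[OF z] by auto
      then have "1 + 2 * B z / (A z - B z) = (1 + \<mu> z) / (1 - \<mu> z)"
        using ne unfolding BA[OF z] by (simp add: divide_simps) (simp add: algebra_simps)
      moreover have "Re ((1 + \<mu> z) / (1 - \<mu> z)) > 0"
        using \<mu>_lt[OF z] by (rule Re_cayley_pos)
      ultimately show ?thesis by simp
    qed
    moreover have "Re (A z - B z) > 0" if "z \<in> unit_disc" for z using pos[OF that] \<alpha> by linarith
    ultimately have "inj_on (\<lambda>z. z * exp (a z) * cnj (exp (b z))) unit_disc"
      unfolding A_def B_def by (intro log_harmonic_injective a b) (simp_all add: add_diff_eq)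
    then show ?thesis by (subst inj_on_cong[OF f])
  qed
  have "f \<in> starlike_log_harmonic \<alpha> \<longleftrightarrow> (\<forall>z\<in>unit_disc. Re (A z - B z) > \<alpha>)"
  proof
    assume f_star: "f \<in> starlike_log_harmonic \<alpha>"
    have "Re (A z - B z) > \<alpha>" if z: "z \<in> unit_disc" "z \<noteq> 0" for z
    proof -
      have "Re ((z * deriv_z f z - cnj z * deriv_zbar f z) / f z) > \<alpha>"
        using f_star z unfolding starlike_log_harmonic_def by blast
      then show ?thesis unfolding Re_eq[OF z] .
    qed
    moreover have "Re (A 0 - B 0) > \<alpha>" using \<alpha> by (simp add: A_def B_def)
    ultimately show "\<forall>z\<in>unit_disc. Re (A z - B z) > \<alpha>" by metis
  next
    assume pos: "\<forall>z\<in>unit_disc. Re (A z - B z) > \<alpha>"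
    then have "Re ((z * deriv_z f z - cnj z * deriv_zbar f z) / f z) > \<alpha>" if "z \<in> unit_disc - {0}" for z
      using Re_eq[of z] that by (metis DiffD1 DiffD2 singletonI)
    moreover have "inj_on f unit_disc" using inj pos by blast
    ultimately show "f \<in> starlike_log_harmonic \<alpha>"
      unfolding starlike_log_harmonic_def using norm_f by blast
  qed
  with \<mu>_hol \<mu>_lt \<mu>0 BA show ?thesis by (rule that)
qed

text \<open>
  The factor \<open>z\<close> hides the derivatives at the origin, but a single exceptional point does not
  prevent a continuous function with zero derivative from being constant.
\<close>

lemma eq_on_disc_if_derivs_eq:
  assumes u: "\<And>z. z \<in> unit_disc \<Longrightarrow> (u has_field_derivative u' z) (at z)"
    and v: "\<And>z. z \<in> unit_disc \<Longrightarrow> (v has_field_derivative v' z) (at z)"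
    and eq: "\<And>z. z \<in> unit_disc \<Longrightarrow> z * u' z = z * v' z" and "u 0 = v 0" and z: "z \<in> unit_disc"
  shows "u z = (v z :: complex)"
proof -
  have D: "((\<lambda>z. u z - v z) has_field_derivative u' z - v' z) (at z)" if "z \<in> unit_disc" for z
    by (intro DERIV_diff u v that)
  then have "continuous_on unit_disc (\<lambda>z. u z - v z)"
    by (intro continuous_at_imp_continuous_on ballI) (blast intro: DERIV_isCont)
  moreover have "\<forall>z\<in>unit_disc - {0}. ((\<lambda>z. u z - v z) has_field_derivative 0) (at z)"
    using D eq by fastforce
  ultimately obtain c where "\<And>z. z \<in> unit_disc \<Longrightarrow> u z - v z = c"
    by (rule DERIV_zero_connected_constant[OF connected_ball open_ball finite.insertI[OF finite.emptyI]]) (rule that)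
  from this[of 0] this[of z] show ?thesis using \<open>u 0 = v 0\<close> z by simp
qed

lemma deriv_unique_if_exp_eq:
  assumes "(u has_field_derivative u') (at z)" "(v has_field_derivative v') (at z)"
    and "\<And>z. z \<in> unit_disc \<Longrightarrow> exp (u z) = exp (v z)" and z: "z \<in> unit_disc"
  shows "u' = (v' :: complex)"
proof -
  have "((\<lambda>z. exp (u z)) has_field_derivative exp (u z) * u') (at z)"
    "((\<lambda>z. exp (v z)) has_field_derivative exp (v z) * v') (at z)"
    using assms(1,2) by (auto intro!: derivative_eq_intros)
  moreover from this(2) have "((\<lambda>z. exp (u z)) has_field_derivative exp (v z) * v') (at z)"
    by (rule has_field_derivative_transform_within_open[OF _ open_ball z]) (simp add: assms(3))
  ultimately have "exp (u z) * u' = exp (v z) * v'" by (blast intro: DERIV_unique)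
  then show ?thesis using assms(3)[OF z] by simp
qed

theorem theorem2p3:
  fixes \<alpha> :: real and f h g :: "complex \<Rightarrow> complex"
  assumes "0 \<le> \<alpha>" and "\<alpha> < 1"
    and "normalized_log_harmonic f h g"
  shows "f \<in> starlike_log_harmonic \<alpha> \<longleftrightarrow>
    (\<exists>\<delta> \<kappa>. circle_prob_measure \<delta> \<and> circle_prob_measure \<kappa> \<and>
       (\<forall>z\<in>unit_disc.
          h z = exp (LINT \<xi>|\<kappa>. (LINT \<eta>|\<delta>. K1 \<alpha> z \<eta> \<xi>)) \<and>
          g z = exp (LINT \<xi>|\<kappa>. (LINT \<eta>|\<delta>. K2 \<alpha> z \<eta> \<xi>))))"
    (is "_ \<longleftrightarrow> ?rep")
proof -
  have series: "exp_power_series h" "exp_power_series g"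
    using assms(3) by (auto simp: normalized_log_harmonic_def)
  obtain a where a: "a holomorphic_on unit_disc" "a 0 = 0" and h: "\<And>z. z \<in> unit_disc \<Longrightarrow> h z = exp (a z)"
    by (rule exp_power_series_logarithm[OF series(1)]) (rule that)
  obtain b where b: "b holomorphic_on unit_disc" "b 0 = 0" and g: "\<And>z. z \<in> unit_disc \<Longrightarrow> g z = exp (b z)"
    by (rule exp_power_series_logarithm[OF series(2)]) (rule that)
  define A where "A z = 1 + z * deriv a z" for z
  define B where "B z = z * deriv b z" for z
  obtain \<mu> where \<mu>: "\<mu> holomorphic_on unit_disc" "\<And>z. z \<in> unit_disc \<Longrightarrow> norm (\<mu> z) < 1" "\<mu> 0 = 0"
    and BA: "\<And>z. z \<in> unit_disc \<Longrightarrow> B z = \<mu> z * A z"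
    and starlike: "f \<in> starlike_log_harmonic \<alpha> \<longleftrightarrow> (\<forall>z\<in>unit_disc. Re (A z - B z) > \<alpha>)"
    by (rule starlike_log_harmonic_iff[OF assms a(1) b(1) h g A_def B_def], assumption, assumption) (rule that)
  have da: "(a has_field_derivative deriv a z) (at z)" and db: "(b has_field_derivative deriv b z) (at z)"
    if "z \<in> unit_disc" for z
    using that holomorphic_derivI[OF a(1) open_ball] holomorphic_derivI[OF b(1) open_ball] by auto
  let ?H1 = "\<lambda>\<delta> \<kappa> z. LINT \<xi>|\<kappa>. LINT \<eta>|\<delta>. K1 \<alpha> z \<eta> \<xi>"
  let ?H2 = "\<lambda>\<delta> \<kappa> z. LINT \<xi>|\<kappa>. LINT \<eta>|\<delta>. K2 \<alpha> z \<eta> \<xi>"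
  show ?thesis
  proof
    \<comment> \<open>\<open>A\<close> and \<open>B\<close> are recovered from \<open>p\<close> and \<open>q\<close>, which encode \<open>A - B = A (1 - \<mu>)\<close> and \<open>\<mu>\<close>;
        applying Herglotz's theorem to each gives the two measures\<close>
    assume "f \<in> starlike_log_harmonic \<alpha>"
    then have pos: "Re (A z - B z) > \<alpha>" if "z \<in> unit_disc" for z using starlike that by blast
    define p where "p z = (A z - B z - of_real \<alpha>) / (1 - of_real \<alpha>)" for z
    define q where "q z = (1 + \<mu> z) / (1 - \<mu> z)" for z
    have \<mu>1: "1 - \<mu> z \<noteq> 0" if "z \<in> unit_disc" for z using \<mu>(2)[OF that] by auto
    have \<alpha>1: "1 - complex_of_real \<alpha> \<noteq> 0" using assms(2) by (metis of_real_1 of_real_diff of_real_eq_0_iff diff_gt_0_iff_gt less_irrefl)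
    have p_hol: "p holomorphic_on unit_disc"
      unfolding p_def A_def B_def using a b \<alpha>1 by (intro holomorphic_intros) auto
    have p_pos: "Re (p z) \<ge> 0" if "z \<in> unit_disc" for z
    proof -
      have "p z = (A z - B z - of_real \<alpha>) / of_real (1 - \<alpha>)" by (simp add: p_def)
      then have "Re (p z) = (Re (A z - B z) - \<alpha>) / (1 - \<alpha>)"
        by (simp only: Re_divide_of_real minus_complex.sel Re_complex_of_real)
      then show ?thesis using pos[OF that] assms(2) by simp
    qed
    have p_0: "p 0 = 1" using \<alpha>1 by (simp add: p_def A_def B_def)
    obtain \<delta> where \<delta>: "circle_prob_measure \<delta>"
      and p: "\<And>z. z \<in> unit_disc \<Longrightarrow> p z = herglotz_integral \<delta> z"
      using herglotz_representation[OF p_hol p_pos p_0] by blast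
    have q_hol: "q holomorphic_on unit_disc"
      unfolding q_def using \<mu>1 by (intro holomorphic_intros \<mu>) auto
    have q_pos: "Re (q z) \<ge> 0" if "z \<in> unit_disc" for z
      unfolding q_def using Re_cayley_pos[OF \<mu>(2)[OF that]] by simp
    have q_0: "q 0 = 1" by (simp add: q_def \<mu>)
    obtain \<kappa> where \<kappa>: "circle_prob_measure \<kappa>"
      and q: "\<And>z. z \<in> unit_disc \<Longrightarrow> q z = herglotz_integral \<kappa> z"
      using herglotz_representation[OF q_hol q_pos q_0] by blast
    have P: "of_real \<alpha> + (1 - of_real \<alpha>) * herglotz_integral \<delta> z = A z * (1 - \<mu> z)" if z: "z \<in> unit_disc" for z
    proof -
      have "(1 - of_real \<alpha>) * p z = A z - B z - of_real \<alpha>" using \<alpha>1 by (simp add: p_def)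
      then show ?thesis unfolding p[OF z, symmetric] by (simp add: BA[OF z] right_diff_distrib mult.commute)
    qed
    have Q: "(herglotz_integral \<kappa> z + 1) / 2 = 1 / (1 - \<mu> z)" "(herglotz_integral \<kappa> z - 1) / 2 = \<mu> z / (1 - \<mu> z)"
      if z: "z \<in> unit_disc" for z
      using \<mu>1[OF z] unfolding q[OF z, symmetric] q_def by (simp_all add: divide_simps)
    have "\<exists>D. (?H1 \<delta> \<kappa> has_field_derivative D) (at z) \<and> z * deriv a z = z * D" if z: "z \<in> unit_disc" for z
    proof -
      have nz: "norm z < 1" using z by simp
      obtain D where D: "(?H1 \<delta> \<kappa> has_field_derivative D) (at z)"
        "z * D = (of_real \<alpha> + (1 - of_real \<alpha>) * herglotz_integral \<delta> z) * ((herglotz_integral \<kappa> z + 1) / 2) - 1"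
        by (rule K1_double_integral_deriv[OF \<delta> \<kappa> nz]) (rule that)
      from D(2) have "z * D = A z - 1" unfolding P[OF z] Q[OF z] using \<mu>1[OF z] by simp
      with D(1) show ?thesis by (auto simp: A_def)
    qed
    then obtain D1 where D1: "\<And>z. z \<in> unit_disc \<Longrightarrow> (?H1 \<delta> \<kappa> has_field_derivative D1 z) (at z)"
      "\<And>z. z \<in> unit_disc \<Longrightarrow> z * deriv a z = z * D1 z" by metis
    have "\<exists>D. (?H2 \<delta> \<kappa> has_field_derivative D) (at z) \<and> z * deriv b z = z * D" if z: "z \<in> unit_disc" for z
    proof -
      have nz: "norm z < 1" using z by simp
      obtain D where D: "(?H2 \<delta> \<kappa> has_field_derivative D) (at z)"
        "z * D = (of_real \<alpha> + (1 - of_real \<alpha>) * herglotz_integral \<delta> z) * ((herglotz_integral \<kappa> z - 1) / 2)"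
        by (rule K2_double_integral_deriv[OF \<delta> \<kappa> nz]) (rule that)
      from D(2) have "z * D = B z" unfolding P[OF z] Q[OF z] using \<mu>1[OF z] by (simp add: BA[OF z])
      with D(1) show ?thesis by (auto simp: B_def)
    qed
    then obtain D2 where D2: "\<And>z. z \<in> unit_disc \<Longrightarrow> (?H2 \<delta> \<kappa> has_field_derivative D2 z) (at z)"
      "\<And>z. z \<in> unit_disc \<Longrightarrow> z * deriv b z = z * D2 z" by metis
    have at_0: "a 0 = ?H1 \<delta> \<kappa> 0" "b 0 = ?H2 \<delta> \<kappa> 0"
      by (simp_all add: a b kernels_at_0)
    have "a z = ?H1 \<delta> \<kappa> z" "b z = ?H2 \<delta> \<kappa> z" if z: "z \<in> unit_disc" for z
      by (rule eq_on_disc_if_derivs_eq[OF da D1 at_0(1) z], assumption+)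
         (rule eq_on_disc_if_derivs_eq[OF db D2 at_0(2) z], assumption+)
    with h g have "\<forall>z\<in>unit_disc. h z = exp (?H1 \<delta> \<kappa> z) \<and> g z = exp (?H2 \<delta> \<kappa> z)" by simp
    with \<delta> \<kappa> show ?rep by blast
  next
    \<comment> \<open>the factors \<open>(q + 1) / 2\<close> and \<open>(q - 1) / 2\<close> differ by \<open>1\<close>, so \<open>q\<close> drops out of \<open>A - B\<close>\<close>
    assume ?rep
    then obtain \<delta> \<kappa> where \<delta>: "circle_prob_measure \<delta>" and \<kappa>: "circle_prob_measure \<kappa>"
      and hg: "\<And>z. z \<in> unit_disc \<Longrightarrow> exp (a z) = exp (?H1 \<delta> \<kappa> z)"
        "\<And>z. z \<in> unit_disc \<Longrightarrow> exp (b z) = exp (?H2 \<delta> \<kappa> z)"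
      using h g by metis
    have "Re (A z - B z) > \<alpha>" if z: "z \<in> unit_disc" for z
    proof -
      have nz: "norm z < 1" using z by simp
      obtain D1 where D1: "(?H1 \<delta> \<kappa> has_field_derivative D1) (at z)"
        "z * D1 = (of_real \<alpha> + (1 - of_real \<alpha>) * herglotz_integral \<delta> z) * ((herglotz_integral \<kappa> z + 1) / 2) - 1"
        by (rule K1_double_integral_deriv[OF \<delta> \<kappa> nz]) (rule that)
      obtain D2 where D2: "(?H2 \<delta> \<kappa> has_field_derivative D2) (at z)"
        "z * D2 = (of_real \<alpha> + (1 - of_real \<alpha>) * herglotz_integral \<delta> z) * ((herglotz_integral \<kappa> z - 1) / 2)"
        by (rule K2_double_integral_deriv[OF \<delta> \<kappa> nz]) (rule that)
      have "deriv a z = D1" "deriv b z = D2"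
        using deriv_unique_if_exp_eq[OF da[OF z] D1(1) hg(1) z] deriv_unique_if_exp_eq[OF db[OF z] D2(1) hg(2) z] by auto
      then have "A z - B z = 1 + z * D1 - z * D2" by (simp add: A_def B_def)
      also have "\<dots> = of_real \<alpha> + of_real (1 - \<alpha>) * herglotz_integral \<delta> z"
        unfolding D1(2) D2(2) by (simp add: field_simps)
      finally have "Re (A z - B z) = \<alpha> + (1 - \<alpha>) * Re (herglotz_integral \<delta> z)" by simp
      then show ?thesis using Re_herglotz_integral_pos[OF \<delta> nz] assms(2) by simp
    qed
    then show "f \<in> starlike_log_harmonic \<alpha>" using starlike by blast
  qed
qed

end
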